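(* Let $A\in\mathbb{Q}_Q(\mathbb{R}^n)$ with signature $S(A)=(J,k_1,\dots,k_J)$. Then the tangent cone $\mathbf{Tan}_A(\mathbb{Q}_Q(\mathbb{R}^n))$ is isometric to the product $\mathbb{Q}_{k_1}(\mathbb{R}^n)\times\mathbb{Q}_{k_2}(\mathbb{R}^n)\times\dots\times\mathbb{Q}_{k_J}(\mathbb{R}^n)$ equipped with the product metric $d\big((X_i)_i,(Y_i)_i\big)=\big(\sum_{i=1}^J\mathcal{G}^2(X_i,Y_i)\big)^{1/2}$.
   Context: $\mathbb{Q}_Q(\mathbb{R}^n)$ denotes the set of unordered $Q$-tuples of points of $\mathbb{R}^n$, written $\sum_{i=1}^Q[[a_i]]$ (two such sums are equal iff the tuples agree up to a permutation; $k[[a]]$ means $k$ copies of $a$), with metric $\mathcal{G}\big(\sum_i[[a_i]],\sum_i[[b_i]]\big)=\min_{\sigma}\big(\sum_{i}|a_i-b_{\sigma(i)}|^2\big)^{1/2}$ over permutations $\sigma$. Signature: every $x$ can be written uniquely as $x=\sum_{i=1}^J k_i[[x_i]]$ with $x_1,\dots,x_J$ distinct and $1\le k_1\le\dots\le k_J$; $S(x):=(J,k_1,\dots,k_J)$. Tangent cone: let $G(A)$ be the set of geodesics issuing from $A$, i.e. curves $\gamma:[0,T_\gamma]\to\mathbb{Q}_Q(\mathbb{R}^n)$ with $\gamma(0)=A$ and $\mathcal{G}(\gamma(s),\gamma(t))=c|t-s|$ for a constant $c\ge0$. For $\gamma_1,\gamma_2\in G(A)$, $d_A(\gamma_1,\gamma_2)=\lim_{t\downarrow0}\mathcal{G}(\gamma_1(t),\gamma_2(t))/t$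 (this limit exists and equals the distance defined via Alexandrov angles). Set $\gamma_1\sim\gamma_2$ if they coincide on some $[0,\epsilon]$, $\epsilon>0$; $d_A$ is a distance on $G(A)/\sim$, and $\mathbf{Tan}_A(\mathbb{Q}_Q(\mathbb{R}^n))$ is the metric completion of $(G(A)/\sim,d_A)$. *)

theory Defs
  imports "HOL-Analysis.Analysis" "HOL-Library.Multiset"
begin

definition QQ :: "nat \<Rightarrow> (real ^ 'n) multiset set" where
  "QQ Q = {A. size A = Q}"

text \<open>The metric G: minimum over matchings (a matching is a multiset of pairs
whose first projections give A and second projections give B, i.e. a permutation).\<close>
definition Gdist :: "(real ^ 'n) multiset \<Rightarrow> (real ^ 'n) multiset \<Rightarrow> real" where
  "Gdist A B = sqrt (Min {sum_mset (image_mset (\<lambda>(a, b). (norm (a - b))\<^sup>2) P) | P.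
      image_mset fst P = A \<and> image_mset snd P = B})"

definition signature :: "(real ^ 'n) multiset \<Rightarrow> nat list" where
  "signature A = sorted_list_of_multiset (image_mset (count A) (mset_set (set_mset A)))"

definition geodesic :: "nat \<Rightarrow> (real ^ 'n) multiset \<Rightarrow> real \<times> (real \<Rightarrow> (real ^ 'n) multiset) \<Rightarrow> bool" where
  "geodesic Q A g \<longleftrightarrow> (case g of (T, \<gamma>) \<Rightarrow>
     0 < T \<and> \<gamma> 0 = A \<and> (\<forall>t\<in>{0..T}. \<gamma> t \<in> QQ Q) \<and>
     (\<exists>c\<ge>0. \<forall>s\<in>{0..T}. \<forall>t\<in>{0..T}. Gdist (\<gamma> s) (\<gamma> t) = c * \<bar>t - s\<bar>))"

definition dA :: "real \<times> (real \<Rightarrow> (real ^ 'n) multiset) \<Rightarrow> real \<times> (real \<Rightarrow> (real ^ 'n) multiset) \<Rightarrow> real" where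
  "dA g1 g2 = Lim (at_right 0) (\<lambda>t. Gdist (snd g1 t) (snd g2 t) / t)"

text \<open>Metric completion of (G(A)/~, d_A): Cauchy sequences of geodesics with the
pseudo-distance lim d_A(sigma n, tau n); the completion is the quotient by
distance zero (which also absorbs ~, since d_A vanishes on equivalent geodesics).\<close>
definition tan_cauchy :: "nat \<Rightarrow> (real ^ 'n) multiset \<Rightarrow> (nat \<Rightarrow> real \<times> (real \<Rightarrow> (real ^ 'n) multiset)) \<Rightarrow> bool" where
  "tan_cauchy Q A \<sigma> \<longleftrightarrow> (\<forall>k. geodesic Q A (\<sigma> k)) \<and>
     (\<forall>e>0. \<exists>N. \<forall>m\<ge>N. \<forall>k\<ge>N. dA (\<sigma> m) (\<sigma> k) < e)"

definition tan_dist :: "(nat \<Rightarrow> real \<times> (real \<Rightarrow> (real ^ 'n) multiset)) \<Rightarrow> (nat \<Rightarrow> real \<times> (real \<Rightarrow> (real ^ 'n) multiset)) \<Rightarrow> real" where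
  "tan_dist \<sigma> \<tau> = lim (\<lambda>k. dA (\<sigma> k) (\<tau> k))"

definition Tan :: "nat \<Rightarrow> (real ^ 'n) multiset \<Rightarrow> (nat \<Rightarrow> real \<times> (real \<Rightarrow> (real ^ 'n) multiset)) set set" where
  "Tan Q A = {\<sigma>. tan_cauchy Q A \<sigma>} // {(\<sigma>, \<tau>). tan_cauchy Q A \<sigma> \<and> tan_cauchy Q A \<tau> \<and> tan_dist \<sigma> \<tau> = 0}"

definition Tan_dist :: "(nat \<Rightarrow> real \<times> (real \<Rightarrow> (real ^ 'n) multiset)) set \<Rightarrow> (nat \<Rightarrow> real \<times> (real \<Rightarrow> (real ^ 'n) multiset)) set \<Rightarrow> real" where
  "Tan_dist X Y = tan_dist (SOME \<sigma>. \<sigma> \<in> X) (SOME \<tau>. \<tau> \<in> Y)"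

definition prodQ :: "nat list \<Rightarrow> (nat \<Rightarrow> (real ^ 'n) multiset) set" where
  "prodQ ks = {X. (\<forall>i<length ks. X i \<in> QQ (ks ! i)) \<and> (\<forall>i\<ge>length ks. X i = {#})}"

definition prodQ_dist :: "nat list \<Rightarrow> (nat \<Rightarrow> (real ^ 'n) multiset) \<Rightarrow> (nat \<Rightarrow> (real ^ 'n) multiset) \<Rightarrow> real" where
  "prodQ_dist ks X Y = sqrt (\<Sum>i<length ks. (Gdist (X i) (Y i))\<^sup>2)"

end

theory Submission
  imports Defs
begin

text \<open>
  Write \<open>A = \<Sum>\<^sub>i k\<^sub>i[[p\<^sub>i]]\<close> with distinct \<open>p\<^sub>i\<close>. Any \<open>B\<close> splits along an optimal matching with \<open>A\<close> into
  clusters \<open>p\<^sub>i + X\<^sub>i\<close>, and as long as the clusters are small compared with the separation of the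
  \<open>p\<^sub>i\<close>, optimal matchings stay inside clusters, so that the metric is locally the product metric of the
  \<open>X\<^sub>i\<close>. If \<open>\<gamma>\<close> is a geodesic from \<open>A\<close>, then \<open>\<gamma>(s)\<close> and \<open>\<gamma>(t)\<close> have squared distances
  \<open>c\<^sup>2s\<^sup>2\<close>, \<open>c\<^sup>2t\<^sup>2\<close> from \<open>A\<close> and \<open>c\<^sup>2(t - s)\<^sup>2\<close> from each other. This is equality in the Cauchy-Schwarz
  inequality for an optimal matching, hence matched displacements are proportional and \<open>\<gamma>(t)\<close> is
  \<open>\<Sum>\<^sub>i (p\<^sub>i + t X\<^sub>i)\<close> near \<open>0\<close>. Thus \<open>\<gamma> \<mapsto> X\<close> is a distance preserving surjection from geodesics onto the
  product, which is already complete, so that completing adds nothing.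
\<close>

section \<open>Matchings\<close>

text \<open>The two element types are independent, so that matchings can themselves be matched, as
  in \<open>glue_matchings\<close>.\<close>

definition matchings :: "'a multiset \<Rightarrow> 'b multiset \<Rightarrow> ('a \<times> 'b) multiset set" where
  "matchings A B = {P. image_mset fst P = A \<and> image_mset snd P = B}"

definition cost :: "('a::real_normed_vector \<times> 'a) multiset \<Rightarrow> real" where
  "cost P = (\<Sum>z\<in>#P. (norm (fst z - snd z))\<^sup>2)"

text \<open>This is the squared distance from \<open>X\<close> to the tuple of zeros of the same
  size, as \<open>Gdist_zeros\<close> shows.\<close>

definition sqnorm :: "'a::real_normed_vector multiset \<Rightarrow> real" where
  "sqnorm X = (\<Sum>x\<in>#X. (norm x)\<^sup>2)"

section \<open>Real sums over multisets, and finite sums of multisets\<close>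

lemma sum_mset_nonneg':
  fixes f :: "'a \<Rightarrow> real"
  assumes "\<And>x. x \<in># M \<Longrightarrow> 0 \<le> f x"
  shows "0 \<le> (\<Sum>x\<in>#M. f x)"
  using assms by (induction M) auto

lemma sum_mset_mono':
  fixes f :: "'a \<Rightarrow> real"
  assumes "\<And>x. x \<in># M \<Longrightarrow> f x \<le> g x"
  shows "(\<Sum>x\<in>#M. f x) \<le> (\<Sum>x\<in>#M. g x)"
  using assms by (induction M) (auto intro!: add_mono)

lemma sum_mset_ge_member:
  fixes f :: "'a \<Rightarrow> real"
  assumes "\<And>x. x \<in># M \<Longrightarrow> 0 \<le> f x" "x \<in># M"
  shows "f x \<le> (\<Sum>x\<in>#M. f x)"
proof -
  obtain N where N: "M = add_mset x N"
    using assms(2) by (meson mset_add)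
  have "0 \<le> (\<Sum>x\<in>#N. f x)"
    using assms(1) N by (intro sum_mset_nonneg') auto
  then show ?thesis by (simp add: N)
qed

lemma image_mset_sum:
  "image_mset f (\<Sum>i\<in>I. X i) = (\<Sum>i\<in>I. image_mset f (X i))"
  by (induction I rule: infinite_finite_induct) auto

lemma sum_mset_sum: "\<Sum>\<^sub># (\<Sum>i\<in>I. X i) = (\<Sum>i\<in>I. \<Sum>\<^sub># (X i))"
  by (induction I rule: infinite_finite_induct) auto

lemma size_sum:
  fixes X :: "'i \<Rightarrow> 'a multiset"
  shows "size (\<Sum>i\<in>I. X i) = (\<Sum>i\<in>I. size (X i))"
  by (induction I rule: infinite_finite_induct) auto

lemma filter_mset_sum: "filter_mset R (\<Sum>i\<in>I. X i) = (\<Sum>i\<in>I. filter_mset R (X i))"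
  by (induction I rule: infinite_finite_induct) auto

lemma cost_nonneg: "0 \<le> cost P"
  unfolding cost_def by (intro sum_mset_nonneg') auto

lemma cost_sum: "cost (\<Sum>i\<in>I. P i) = (\<Sum>i\<in>I. cost (P i))"
  by (simp add: cost_def image_mset_sum sum_mset_sum)

lemma sqnorm_nonneg: "0 \<le> sqnorm X"
  unfolding sqnorm_def by (intro sum_mset_nonneg') auto

section \<open>Existence of optimal matchings\<close>

lemma finite_multisets_bounded:
  assumes "finite S"
  shows "finite {P. set_mset P \<subseteq> S \<and> size P = n}"
proof -
  have "{P. set_mset P \<subseteq> S \<and> size P = n} \<subseteq> mset ` {xs. set xs \<subseteq> S \<and> length xs = n}"
  proof
    fix P assume P: "P \<in> {P. set_mset P \<subseteq> S \<and> size P = n}"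
    obtain xs where "mset xs = P" using ex_mset by blast
    with P show "P \<in> mset ` {xs. set xs \<subseteq> S \<and> length xs = n}" by force
  qed
  then show ?thesis
    by (rule finite_subset) (simp add: finite_lists_length_eq assms)
qed

text \<open>Every matching has the size of \<open>A\<close> and uses pairs from a finite set.
  Together with \<open>matchings_nonempty\<close> this makes the \<open>Min\<close> in
  \<open>Gdist\<close> an attained minimum.\<close>

lemma finite_matchings: "finite (matchings A B)"
proof -
  have "matchings A B \<subseteq> {P. set_mset P \<subseteq> set_mset A \<times> set_mset B \<and> size P = size A}"
    by (force simp: matchings_def)
  then show ?thesis
    by (rule finite_subset) (simp add: finite_multisets_bounded)
qed

lemma matchings_nonempty:
  assumes "size A = size B"
  shows "matchings A B \<noteq> {}"
proof -
  obtain xs ys where xy: "mset xs = A" "mset ys = B" using ex_mset by metis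
  then have "length xs = length ys" using assms by auto
  then have "mset (zip xs ys) \<in> matchings A B"
    by (simp add: matchings_def xy flip: mset_map)
  then show ?thesis by blast
qed

lemma Gdist_eq_Min: "Gdist A B = sqrt (Min (cost ` matchings A B))"
proof -
  have "{sum_mset (image_mset (\<lambda>(a, b). (norm (a - b))\<^sup>2) P) | P.
      image_mset fst P = A \<and> image_mset snd P = B} = cost ` matchings A B"
    by (auto simp: matchings_def cost_def case_prod_unfold image_def)
  then show ?thesis by (simp add: Gdist_def)
qed

lemma Gdist_optimal:
  assumes "size A = size B"
  obtains P where "P \<in> matchings A B" "cost P = (Gdist A B)\<^sup>2"
proof -
  have "Min (cost ` matchings A B) \<in> cost ` matchings A B"
    using finite_matchings matchings_nonempty[OF assms] by (intro Min_in) auto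
  then obtain P where P: "P \<in> matchings A B" "cost P = Min (cost ` matchings A B)"
    by auto
  then have "cost P = (Gdist A B)\<^sup>2"
    by (metis Gdist_eq_Min cost_nonneg real_sqrt_pow2)
  with P that show thesis by blast
qed

text \<open>For unequal sizes there is no matching and \<open>Min\<close> is taken over the empty
  set, so even the sign of \<open>Gdist\<close> rests on the size hypothesis.\<close>

lemma Gdist_nonneg:
  assumes "size A = size B"
  shows "0 \<le> Gdist A B"
proof -
  have "Min (cost ` matchings A B) \<in> cost ` matchings A B"
    using finite_matchings matchings_nonempty[OF assms] by (intro Min_in) auto
  then show ?thesis using cost_nonneg by (auto simp: Gdist_eq_Min)
qed

lemma Gdist_le_cost:
  assumes "P \<in> matchings A B"
  shows "(Gdist A B)\<^sup>2 \<le> cost P"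
proof -
  have "Min (cost ` matchings A B) \<in> cost ` matchings A B"
    using finite_matchings assms by (intro Min_in) auto
  then have "0 \<le> Min (cost ` matchings A B)"
    using cost_nonneg by auto
  moreover have "Min (cost ` matchings A B) \<le> cost P"
    using finite_matchings assms by (intro Min_le) auto
  ultimately show ?thesis by (simp add: Gdist_eq_Min)
qed

section \<open>Symmetry, dilations, translations and the triangle inequality\<close>

lemma matchings_swap:
  fixes A :: "'a multiset" and B :: "'b multiset"
  shows "P \<in> matchings A B \<Longrightarrow> image_mset prod.swap P \<in> matchings B A"
proof -
  have "fst \<circ> prod.swap = (snd :: 'a \<times> 'b \<Rightarrow> 'b)" "snd \<circ> prod.swap = (fst :: 'a \<times> 'b \<Rightarrow> 'a)"
    by auto
  then show "image_mset prod.swap P \<in> matchings B A" if "P \<in> matchings A B"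
    using that by (auto simp: matchings_def multiset.map_comp)
qed

lemma cost_swap:
  fixes P :: "('a::real_normed_vector \<times> 'a) multiset"
  shows "cost (image_mset prod.swap P) = cost P"
proof -
  have "(\<lambda>z. (norm (fst z - snd z))\<^sup>2) \<circ> prod.swap = (\<lambda>z::'a \<times> 'a. (norm (fst z - snd z))\<^sup>2)"
    by (simp add: fun_eq_iff norm_minus_commute)
  then show ?thesis by (simp add: cost_def multiset.map_comp)
qed

lemma Gdist_commute:
  fixes A B :: "(real ^ 'n) multiset"
  shows "Gdist A B = Gdist B A"
proof -
  have "cost ` matchings A B \<subseteq> cost ` matchings B A" for A B :: "(real^'n) multiset"
  proof
    fix c assume "c \<in> cost ` matchings A B"
    then obtain P where "P \<in> matchings A B" "c = cost (image_mset prod.swap P)"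
      by (auto simp: cost_swap)
    then show "c \<in> cost ` matchings B A"
      using matchings_swap by blast
  qed
  then show ?thesis by (metis Gdist_eq_Min subset_antisym)
qed

text \<open>Pushing an optimal matching forward along \<open>f\<close> and \<open>g\<close>
  multiplies the length of each pair by \<open>c\<close>.\<close>

lemma Gdist_image_le:
  fixes f g :: "real ^ 'n \<Rightarrow> real ^ 'n"
  assumes "size A = size B" and "\<And>a b. norm (f a - g b) = c * norm (a - b)"
  shows "(Gdist (image_mset f A) (image_mset g B))\<^sup>2 \<le> c\<^sup>2 * (Gdist A B)\<^sup>2"
proof -
  obtain P where P: "P \<in> matchings A B" "cost P = (Gdist A B)\<^sup>2"
    using Gdist_optimal assms(1) by blast
  have "image_mset (map_prod f g) P \<in> matchings (image_mset f A) (image_mset g B)"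
    using P(1) by (auto simp: matchings_def multiset.map_comp comp_def)
  moreover have "cost (image_mset (map_prod f g) P) = c\<^sup>2 * cost P"
    by (simp add: cost_def multiset.map_comp comp_def assms(2) power_mult_distrib sum_mset_distrib_left)
  ultimately show ?thesis using Gdist_le_cost P(2) by metis
qed

text \<open>One inequality comes from \<open>Gdist_image_le\<close> with factor \<open>t\<close>,
  the other from the same bound with factor \<open>1/t\<close> applied to the dilated multisets. For
  \<open>t = 0\<close> the first inequality alone forces both sides to vanish.\<close>

lemma Gdist_scale:
  fixes A B :: "(real ^ 'n) multiset"
  assumes "size A = size B" "0 \<le> t"
  shows "Gdist (image_mset ((*\<^sub>R) t) A) (image_mset ((*\<^sub>R) t) B) = t * Gdist A B"
proof -
  let ?S = "\<lambda>t. image_mset ((*\<^sub>R) t)"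
  have *: "(Gdist (?S t A) (?S t B))\<^sup>2 \<le> t\<^sup>2 * (Gdist A B)\<^sup>2"
    if "size A = size B" "0 \<le> t" for t :: real and A B :: "(real^'n) multiset"
  proof (rule Gdist_image_le[OF that(1)])
    show "norm (t *\<^sub>R a - t *\<^sub>R b) = t * norm (a - b)" for a b :: "real^'n"
      using that(2) by (metis abs_of_nonneg norm_scaleR scaleR_diff_right)
  qed
  have nn: "0 \<le> Gdist (?S t A) (?S t B)" "0 \<le> Gdist A B"
    using assms by (auto intro!: Gdist_nonneg)
  have "(Gdist (?S t A) (?S t B))\<^sup>2 = (t * Gdist A B)\<^sup>2"
  proof (cases "t = 0")
    case True
    then show ?thesis using *[OF assms] by simp
  next
    case False
    then have "(Gdist A B)\<^sup>2 \<le> (1/t)\<^sup>2 * (Gdist (?S t A) (?S t B))\<^sup>2"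
      using *[of "?S t A" "?S t B" "1/t"] assms
      by (simp add: multiset.map_comp comp_def)
    then have "t\<^sup>2 * (Gdist A B)\<^sup>2 \<le> (Gdist (?S t A) (?S t B))\<^sup>2"
      using False by (simp add: power_divide pos_le_divide_eq mult.commute)
    with *[OF assms] show ?thesis by (simp add: power_mult_distrib)
  qed
  then show ?thesis using nn assms(2) by simp
qed

lemma Gdist_translate_le:
  assumes "size A = size B"
  shows "(Gdist (image_mset ((+) p) A) (image_mset ((+) p) B))\<^sup>2 \<le> (Gdist A B)\<^sup>2"
proof -
  have "(Gdist (image_mset ((+) p) A) (image_mset ((+) p) B))\<^sup>2 \<le> 1\<^sup>2 * (Gdist A B)\<^sup>2"
    by (rule Gdist_image_le[OF assms]) simp
  then show ?thesis by simp
qed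

lemma Gdist_translate:
  fixes A B :: "(real ^ 'n) multiset"
  assumes "size A = size B"
  shows "(Gdist (image_mset ((+) p) A) (image_mset ((+) p) B))\<^sup>2 = (Gdist A B)\<^sup>2"
proof (rule antisym)
  have "(+) (- p) \<circ> (+) p = id" by (simp add: fun_eq_iff)
  then have "image_mset ((+) (- p)) (image_mset ((+) p) X) = X" for X :: "(real^'n) multiset"
    by (simp only: multiset.map_comp multiset.map_id)
  then show "(Gdist A B)\<^sup>2 \<le> (Gdist (image_mset ((+) p) A) (image_mset ((+) p) B))\<^sup>2"
    using Gdist_translate_le[of "image_mset ((+) p) A" "image_mset ((+) p) B" "- p"] assms by auto
qed (rule Gdist_translate_le[OF assms])

text \<open>This composes couplings along a common marginal. In the induction, an element of
  \<open>P\<close> with value \<open>f x\<close> has a partner in \<open>R\<close> with the same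
  value, and both are removed.\<close>

lemma glue_matchings:
  assumes "image_mset f P = image_mset g R"
  shows "\<exists>T \<in> matchings P R. \<forall>z\<in>#T. f (fst z) = g (snd z)"
  using assms
proof (induction P arbitrary: R)
  case empty
  then show ?case by (intro bexI[of _ "{#}"]) (auto simp: matchings_def)
next
  case (add x P)
  then obtain R' y where R: "R = add_mset y R'" "g y = f x" "image_mset g R' = image_mset f P"
    using msed_map_invR[of g R "f x" "image_mset f P"] by auto
  then obtain T where T: "T \<in> matchings P R'" "\<forall>z\<in>#T. f (fst z) = g (snd z)"
    using add.IH[of R'] by auto
  then show ?case
    using R by (intro bexI[of _ "add_mset (x, y) T"]) (auto simp: matchings_def)
qed

text \<open>Minkowski's inequality, carried over from \<open>L2_set\<close> by listing the multiset,
  so that repeated elements receive separate indices.\<close>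

lemma sqrt_sum_mset_triangle:
  fixes f g :: "'a \<Rightarrow> real"
  shows "sqrt (\<Sum>x\<in>#M. (f x + g x)\<^sup>2) \<le> sqrt (\<Sum>x\<in>#M. (f x)\<^sup>2) + sqrt (\<Sum>x\<in>#M. (g x)\<^sup>2)"
proof -
  obtain xs where xs: "mset xs = M" using ex_mset by blast
  have *: "(\<Sum>x\<in>#M. h x) = (\<Sum>i<length xs. h (xs ! i))" for h :: "'a \<Rightarrow> real"
    unfolding xs[symmetric]
    by (simp add: sum_mset_sum_list sum_list_sum_nth atLeast0LessThan flip: mset_map)
  show ?thesis
    using L2_set_triangle_ineq[of "\<lambda>i. f (xs ! i)" "\<lambda>i. g (xs ! i)" "{..<length xs}"]
    by (simp add: * L2_set_def)
qed

lemma Gdist_triangle: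
  assumes "size A = size B" "size B = size C"
  shows "Gdist A C \<le> Gdist A B + Gdist B C"
proof -
  obtain P R where P: "P \<in> matchings A B" "cost P = (Gdist A B)\<^sup>2"
    and R: "R \<in> matchings B C" "cost R = (Gdist B C)\<^sup>2"
    using Gdist_optimal assms by metis
  obtain T where T: "T \<in> matchings P R" "\<forall>z\<in>#T. snd (fst z) = fst (snd z)"
    using glue_matchings[of snd P fst R] P R by (auto simp: matchings_def)
  \<comment> \<open>Each element of \<open>T\<close> is a pair from \<open>P\<close> followed by a
    pair from \<open>R\<close> sharing the middle point in \<open>B\<close>; forgetting that point
    leaves a matching of \<open>A\<close> with \<open>C\<close>.\<close>
  let ?S = "image_mset (\<lambda>z. (fst (fst z), snd (snd z))) T"
  have TP: "image_mset fst T = P" "image_mset snd T = R"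
    using T by (auto simp: matchings_def)
  have "?S \<in> matchings A C"
    using P R TP by (auto simp: matchings_def multiset.map_comp comp_def)
  then have "(Gdist A C)\<^sup>2 \<le> cost ?S" by (rule Gdist_le_cost)
  then have "Gdist A C \<le> sqrt (cost ?S)" by (rule real_le_rsqrt)
  also have "cost ?S = (\<Sum>z\<in>#T. (norm (fst (fst z) - snd (snd z)))\<^sup>2)"
    by (simp add: cost_def multiset.map_comp comp_def)
  also have "sqrt \<dots> \<le> sqrt (\<Sum>z\<in>#T. (norm (fst (fst z) - snd (fst z)) + norm (fst (snd z) - snd (snd z)))\<^sup>2)"
  proof (intro real_sqrt_le_mono sum_mset_mono' power_mono)
    fix z assume "z \<in># T"
    then have "fst (fst z) - snd (snd z) = (fst (fst z) - snd (fst z)) + (fst (snd z) - snd (snd z))"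
      using T(2) by auto
    then show "norm (fst (fst z) - snd (snd z)) \<le> norm (fst (fst z) - snd (fst z)) + norm (fst (snd z) - snd (snd z))"
      by (metis norm_triangle_ineq)
  qed auto
  also have "\<dots> \<le> sqrt (\<Sum>z\<in>#T. (norm (fst (fst z) - snd (fst z)))\<^sup>2) +
      sqrt (\<Sum>z\<in>#T. (norm (fst (snd z) - snd (snd z)))\<^sup>2)"
    by (rule sqrt_sum_mset_triangle)
  also have "\<dots> = sqrt (cost P) + sqrt (cost R)"
    by (simp add: cost_def TP[symmetric] multiset.map_comp comp_def)
  also have "\<dots> = Gdist A B + Gdist B C"
    using P R Gdist_nonneg[OF assms(1)] Gdist_nonneg[OF assms(2)] by simp
  finally show ?thesis .
qed

section \<open>Definiteness, and distances to the tuple of zeros\<close>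

lemma sum_mset_eq_0_member:
  fixes f :: "'a \<Rightarrow> real"
  assumes "\<And>x. x \<in># M \<Longrightarrow> 0 \<le> f x" "(\<Sum>x\<in>#M. f x) = 0" "x \<in># M"
  shows "f x = 0"
  using sum_mset_ge_member[of M f x] assms by (metis order_antisym)

lemma Gdist_eq_0_iff:
  assumes "size A = size B"
  shows "Gdist A B = 0 \<longleftrightarrow> A = B"
proof
  assume 0: "Gdist A B = 0"
  obtain P where P: "P \<in> matchings A B" "cost P = 0"
    using Gdist_optimal[OF assms] 0 by (metis power_zero_numeral)
  have "(norm (fst z - snd z))\<^sup>2 = 0" if "z \<in># P" for z
    using sum_mset_eq_0_member[of P "\<lambda>z. (norm (fst z - snd z))\<^sup>2" z] P that
    by (auto simp: cost_def)
  then have "image_mset fst P = image_mset snd P"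
    by (intro image_mset_cong) simp
  then show "A = B" using P(1) unfolding matchings_def by auto
next
  assume "A = B"
  then have "image_mset (\<lambda>a. (a, a)) A \<in> matchings A B"
    by (simp add: matchings_def multiset.map_comp comp_def)
  from Gdist_le_cost[OF this] show "Gdist A B = 0"
    by (simp add: cost_def multiset.map_comp comp_def)
qed

text \<open>A matching with copies of zero has no freedom: each element is paired with zero, so the
  optimal cost is the sum of the squared norms.\<close>

lemma Gdist_zeros: "(Gdist X (replicate_mset (size X) 0))\<^sup>2 = sqnorm X"
proof -
  obtain P where P: "P \<in> matchings X (replicate_mset (size X) 0)"
    "cost P = (Gdist X (replicate_mset (size X) 0))\<^sup>2"
    using Gdist_optimal by (metis size_replicate_mset)
  have "snd z = 0" if "z \<in># P" for z
  proof -
    have "snd z \<in> set_mset (image_mset snd P)" using that by simp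
    moreover have "image_mset snd P = replicate_mset (size X) 0"
      using P(1) unfolding matchings_def by simp
    ultimately have "snd z \<in># replicate_mset (size X) 0" by (simp only:)
    then show ?thesis by (simp split: if_splits)
  qed
  then have "cost P = (\<Sum>z\<in>#P. (norm (fst z))\<^sup>2)"
    unfolding cost_def by (intro arg_cong[of _ _ sum_mset] image_mset_cong) simp
  also have "\<dots> = sqnorm X"
    using P(1) by (auto simp: sqnorm_def matchings_def multiset.map_comp comp_def)
  finally show ?thesis using P by simp
qed

lemma sqnorm_scale: "sqnorm (image_mset ((*\<^sub>R) t) X) = t\<^sup>2 * sqnorm X"
  by (simp add: sqnorm_def multiset.map_comp comp_def power_mult_distrib sum_mset_distrib_left)

text \<open>The lower bound is the reverse triangle inequality through the tuple of zeros, whose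
  distances from the dilated tuples are known. The upper bound is the cost of pairing
  \<open>s *\<^sub>R x\<close> with \<open>t *\<^sub>R x\<close>.\<close>

lemma Gdist_scale_same:
  assumes "0 \<le> s" "0 \<le> t"
  shows "(Gdist (image_mset ((*\<^sub>R) s) X) (image_mset ((*\<^sub>R) t) X))\<^sup>2 = (t - s)\<^sup>2 * sqnorm X"
proof -
  let ?S = "\<lambda>t. image_mset ((*\<^sub>R) t) X" and ?O = "replicate_mset (size X) 0"
  have Z: "Gdist (?S u) ?O = u * sqrt (sqnorm X)" if "0 \<le> u" for u
  proof -
    have "(Gdist (?S u) ?O)\<^sup>2 = (u * sqrt (sqnorm X))\<^sup>2"
      using Gdist_zeros[of "?S u"] by (simp add: sqnorm_scale power_mult_distrib sqnorm_nonneg)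
    then show ?thesis
      by (metis Gdist_nonneg mult_nonneg_nonneg power2_eq_iff_nonneg real_sqrt_ge_zero size_image_mset
          size_replicate_mset sqnorm_nonneg that)
  qed
  have "Gdist (?S t) ?O \<le> Gdist (?S t) (?S s) + Gdist (?S s) ?O"
    "Gdist (?S s) ?O \<le> Gdist (?S s) (?S t) + Gdist (?S t) ?O"
    by (auto intro!: Gdist_triangle)
  then have "\<bar>t - s\<bar> * sqrt (sqnorm X) \<le> Gdist (?S s) (?S t)"
    by (simp add: Z assms Gdist_commute[of "?S t" "?S s"] abs_if left_diff_distrib)
  from power_mono[OF this, of 2] have "(t - s)\<^sup>2 * sqnorm X \<le> (Gdist (?S s) (?S t))\<^sup>2"
    by (simp add: sqnorm_nonneg power_mult_distrib)
  moreover have "(Gdist (?S s) (?S t))\<^sup>2 \<le> (t - s)\<^sup>2 * sqnorm X"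
  proof -
    have "image_mset (\<lambda>x. (s *\<^sub>R x, t *\<^sub>R x)) X \<in> matchings (?S s) (?S t)"
      by (simp add: matchings_def multiset.map_comp comp_def)
    moreover have "cost (image_mset (\<lambda>x. (s *\<^sub>R x, t *\<^sub>R x)) X) = (t - s)\<^sup>2 * sqnorm X"
      by (simp add: cost_def sqnorm_def multiset.map_comp comp_def power_mult_distrib
          sum_mset_distrib_left power2_commute[of t s] flip: scaleR_diff_left)
    ultimately show ?thesis using Gdist_le_cost by metis
  qed
  ultimately show ?thesis by simp
qed

text \<open>The parallelogram law is applied to each pair. Since the bound holds for an arbitrary
  matching, it controls the distance between two clusters a priori.\<close>

lemma cost_le_sqnorm:
  fixes P :: "('a::real_inner \<times> 'a) multiset"
  assumes "P \<in> matchings X Y"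
  shows "cost P \<le> 2 * sqnorm X + 2 * sqnorm Y"
proof -
  have "cost P \<le> (\<Sum>z\<in>#P. 2 * (norm (fst z))\<^sup>2 + 2 * (norm (snd z))\<^sup>2)"
    unfolding cost_def
  proof (rule sum_mset_mono')
    fix z :: "'a \<times> 'a"
    have "(norm (fst z - snd z))\<^sup>2 + (norm (fst z + snd z))\<^sup>2 = 2 * (norm (fst z))\<^sup>2 + 2 * (norm (snd z))\<^sup>2"
      by (simp add: power2_norm_eq_inner algebra_simps inner_commute)
    then show "(norm (fst z - snd z))\<^sup>2 \<le> 2 * (norm (fst z))\<^sup>2 + 2 * (norm (snd z))\<^sup>2"
      by (smt (verit) zero_le_power2)
  qed
  also have "\<dots> = 2 * sqnorm X + 2 * sqnorm Y"
    using assms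
    by (auto simp: matchings_def sqnorm_def sum_mset.distrib multiset.map_comp comp_def sum_mset_distrib_left)
  finally show ?thesis .
qed

section \<open>Clusters around separated points\<close>

text \<open>\<open>X\<close> is a family of displacements: the points of \<open>X i\<close> are
  vectors attached at \<open>p i\<close>. Later \<open>p\<close> enumerates the support of
  \<open>A\<close>, and \<open>spread p I\<close> serves as a chart around \<open>A\<close>.\<close>

definition spread :: "('i \<Rightarrow> 'a::plus) \<Rightarrow> 'i set \<Rightarrow> ('i \<Rightarrow> 'a multiset) \<Rightarrow> 'a multiset" where
  "spread p I X = (\<Sum>i\<in>I. image_mset ((+) (p i)) (X i))"

text \<open>The index is the last argument so that \<open>dilate t X\<close> is again a family that
  can be passed to \<open>spread\<close>.\<close>

definition dilate :: "real \<Rightarrow> ('i \<Rightarrow> 'a::real_vector multiset) \<Rightarrow> 'i \<Rightarrow> 'a multiset" where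
  "dilate t X i = image_mset ((*\<^sub>R) t) (X i)"

lemma size_spread: "size (spread p I X) = (\<Sum>i\<in>I. size (X i))"
  by (simp add: spread_def size_sum)

lemma size_dilate [simp]: "size (dilate t X i) = size (X i)"
  by (simp add: dilate_def)

lemma mset_partition:
  assumes "finite I" "\<And>z. z \<in># P \<Longrightarrow> \<exists>!i. i \<in> I \<and> R i z"
  shows "P = (\<Sum>i\<in>I. filter_mset (R i) P)"
proof (rule multiset_eqI)
  fix z
  show "count P z = count (\<Sum>i\<in>I. filter_mset (R i) P) z"
  proof (cases "z \<in># P")
    case True
    then obtain i where i: "i \<in> I" "R i z" "\<And>j. j \<in> I \<Longrightarrow> R j z \<Longrightarrow> j = i"
      using assms(2) by metis
    have "count (filter_mset (R j) P) z = (if j = i then count P z else 0)" if "j \<in> I" for j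
      using i(2) i(3)[OF that] by (cases "R j z") auto
    then have "count (\<Sum>i\<in>I. filter_mset (R i) P) z = (\<Sum>j\<in>I. if j = i then count P z else 0)"
      unfolding count_sum by (rule sum.cong[OF refl])
    also have "\<dots> = count P z" using i(1) assms(1) by simp
    finally show ?thesis by simp
  next
    case False
    then have "count P z = 0" by (simp add: not_in_iff)
    then have "count (filter_mset (R i) P) z = 0" for i by simp
    then show ?thesis using \<open>count P z = 0\<close> by (simp only: count_sum sum.neutral_const)
  qed
qed

lemma norm_le_of_sqnorm_sum:
  assumes "finite I" "(\<Sum>i\<in>I. sqnorm (X i)) \<le> r\<^sup>2" "0 \<le> r" "i \<in> I" "x \<in># X i"
  shows "norm x \<le> r"
proof -
  have "(norm x)\<^sup>2 \<le> sqnorm (X i)"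
    unfolding sqnorm_def using assms(5) by (intro sum_mset_ge_member) auto
  also have "\<dots> \<le> (\<Sum>i\<in>I. sqnorm (X i))"
    using assms by (intro member_le_sum) (auto simp: sqnorm_nonneg)
  also note assms(2)
  finally show ?thesis using assms(3) by (rule power2_le_imp_le)
qed

lemma Gdist_spread_le:
  fixes X Y :: "'i \<Rightarrow> (real ^ 'n) multiset"
  assumes "\<And>i. i \<in> I \<Longrightarrow> size (X i) = size (Y i)"
  shows "(Gdist (spread p I X) (spread p I Y))\<^sup>2 \<le> (\<Sum>i\<in>I. (Gdist (X i) (Y i))\<^sup>2)"
proof -
  have "\<exists>P. P \<in> matchings (image_mset ((+) (p i)) (X i)) (image_mset ((+) (p i)) (Y i)) \<and>
    cost P = (Gdist (X i) (Y i))\<^sup>2" if "i \<in> I" for i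
    using Gdist_optimal[of "image_mset ((+) (p i)) (X i)" "image_mset ((+) (p i)) (Y i)"]
      Gdist_translate[OF assms[OF that]] assms[OF that] by (metis size_image_mset)
  then obtain P where P: "\<And>i. i \<in> I \<Longrightarrow>
      P i \<in> matchings (image_mset ((+) (p i)) (X i)) (image_mset ((+) (p i)) (Y i))"
    "\<And>i. i \<in> I \<Longrightarrow> cost (P i) = (Gdist (X i) (Y i))\<^sup>2"
    by metis
  have "(\<Sum>i\<in>I. P i) \<in> matchings (spread p I X) (spread p I Y)"
    using P(1) by (auto simp: matchings_def spread_def image_mset_sum intro!: sum.cong)
  from Gdist_le_cost[OF this] show ?thesis
    by (simp add: cost_sum P(2))
qed

text \<open>Matching cluster by cluster costs at most \<open>(2 * r)\<^sup>2\<close>, so an optimal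
  matching joins only points at distance at most \<open>2 * r\<close>. A pair joining different
  clusters would put their centres within \<open>r + 2 * r + r < \<delta>\<close>. Hence an optimal
  matching splits into matchings of the clusters.\<close>

lemma Gdist_spread:
  fixes X Y :: "'i \<Rightarrow> (real ^ 'n) multiset"
  assumes fin: "finite I" and sep: "\<And>i j. i \<in> I \<Longrightarrow> j \<in> I \<Longrightarrow> i \<noteq> j \<Longrightarrow> \<delta> \<le> norm (p i - p j)"
    and size: "\<And>i. i \<in> I \<Longrightarrow> size (X i) = size (Y i)"
    and X: "(\<Sum>i\<in>I. sqnorm (X i)) \<le> r\<^sup>2" and Y: "(\<Sum>i\<in>I. sqnorm (Y i)) \<le> r\<^sup>2"
    and r: "0 \<le> r" "4 * r < \<delta>"
  shows "(Gdist (spread p I X) (spread p I Y))\<^sup>2 = (\<Sum>i\<in>I. (Gdist (X i) (Y i))\<^sup>2)"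
proof (rule antisym)
  show le: "(Gdist (spread p I X) (spread p I Y))\<^sup>2 \<le> (\<Sum>i\<in>I. (Gdist (X i) (Y i))\<^sup>2)"
    using size by (rule Gdist_spread_le)
  have "size (spread p I X) = size (spread p I Y)"
    unfolding size_spread using size by (intro sum.cong) auto
  then obtain P where P: "P \<in> matchings (spread p I X) (spread p I Y)"
      "cost P = (Gdist (spread p I X) (spread p I Y))\<^sup>2"
    using Gdist_optimal by blast
  have "(Gdist (X i) (Y i))\<^sup>2 \<le> 2 * sqnorm (X i) + 2 * sqnorm (Y i)" if i: "i \<in> I" for i
  proof -
    obtain R where "R \<in> matchings (X i) (Y i)"
      using matchings_nonempty[OF size[OF i]] by blast
    then show ?thesis using Gdist_le_cost cost_le_sqnorm order_trans by blast
  qed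
  then have "(\<Sum>i\<in>I. (Gdist (X i) (Y i))\<^sup>2) \<le> (\<Sum>i\<in>I. 2 * sqnorm (X i) + 2 * sqnorm (Y i))"
    by (rule sum_mono)
  also have "\<dots> \<le> (2 * r)\<^sup>2"
    using X Y by (simp add: sum.distrib flip: sum_distrib_left)
  finally have cP: "cost P \<le> (2 * r)\<^sup>2" using le P(2) by simp
  have near: "norm (fst z - snd z) \<le> 2 * r" if "z \<in># P" for z
  proof -
    have "(norm (fst z - snd z))\<^sup>2 \<le> cost P"
      unfolding cost_def using that by (intro sum_mset_ge_member) auto
    then have "(norm (fst z - snd z))\<^sup>2 \<le> (2 * r)\<^sup>2" using cP by linarith
    then show ?thesis by (rule power2_le_imp_le) (use r in simp)
  qed
  have spreadD: "\<exists>i\<in>I. norm (b - p i) \<le> r"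
    if b: "b \<in># spread p I Z" and Z: "(\<Sum>i\<in>I. sqnorm (Z i)) \<le> r\<^sup>2" for b Z
  proof -
    obtain i x where "i \<in> I" "x \<in># Z i" "b = p i + x"
      using b fin by (auto simp: spread_def set_mset_sum)
    then show ?thesis
      using norm_le_of_sqnorm_sum[OF fin Z r(1)] by (intro bexI[of _ i]) auto
  qed
  have same: "i = j" if "i \<in> I" "j \<in> I" "norm (b - p i) \<le> r" "norm (c - p j) \<le> r"
    "norm (b - c) \<le> 2 * r" for i j b c
  proof (rule ccontr)
    assume "i \<noteq> j"
    have "norm (p i - p j) \<le> norm (b - c) + norm (b - p i) + norm (c - p j)"
      by norm
    with sep[OF that(1,2) \<open>i \<noteq> j\<close>] that r show False by linarith
  qed
  \<comment> \<open>The closed ball of radius \<open>r\<close> around \<open>p i\<close> recovers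
    exactly the \<open>i\<close>-th cluster, with multiplicities.\<close>
  have filter_spread: "filter_mset (\<lambda>b. norm (b - p i) \<le> r) (spread p I Z) = image_mset ((+) (p i)) (Z i)"
    if "i \<in> I" "(\<Sum>i\<in>I. sqnorm (Z i)) \<le> r\<^sup>2" for i Z
  proof -
    have "filter_mset (\<lambda>b. norm (b - p i) \<le> r) (image_mset ((+) (p j)) (Z j)) =
      (if j = i then image_mset ((+) (p i)) (Z i) else {#})" if "j \<in> I" for j
    proof -
      have nz: "norm x \<le> r" if "x \<in># Z j" for x
        using norm_le_of_sqnorm_sum[OF fin \<open>(\<Sum>i\<in>I. sqnorm (Z i)) \<le> r\<^sup>2\<close> r(1) \<open>j \<in> I\<close> that] .
      show ?thesis
      proof (cases "j = i")
        case True
        then show ?thesis using nz by (auto simp: filter_mset_eq_conv)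
      next
        case False
        have "\<not> norm (b - p i) \<le> r" if "b \<in># image_mset ((+) (p j)) (Z j)" for b
          using that nz same[of i j b b] False \<open>i \<in> I\<close> \<open>j \<in> I\<close> r by auto
        then have "filter_mset (\<lambda>b. norm (b - p i) \<le> r) (image_mset ((+) (p j)) (Z j)) = {#}"
          by (auto simp: filter_mset_eq_conv)
        then show ?thesis using False by simp
      qed
    qed
    then have "filter_mset (\<lambda>b. norm (b - p i) \<le> r) (spread p I Z) =
      (\<Sum>j\<in>I. if j = i then image_mset ((+) (p i)) (Z i) else {#})"
      unfolding spread_def filter_mset_sum by (intro sum.cong) auto
    then show ?thesis using fin \<open>i \<in> I\<close> by simp
  qed
  define P' where "P' i = filter_mset (\<lambda>z. norm (fst z - p i) \<le> r) P" for i
  have proj: "image_mset fst P = spread p I X" "image_mset snd P = spread p I Y"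
    using P(1) by (auto simp: matchings_def)
  have fstP: "fst z \<in># spread p I X" and sndP: "snd z \<in># spread p I Y" if "z \<in># P" for z
    using that by (auto simp flip: proj)
  \<comment> \<open>Both ends of a pair lie in the same ball. Selecting pairs by their first or by
    their second component therefore gives the same part of \<open>P\<close>, which has both
    projections under control.\<close>
  have iff: "norm (fst z - p i) \<le> r \<longleftrightarrow> norm (snd z - p i) \<le> r" if z: "z \<in># P" and i: "i \<in> I" for z i
  proof -
    obtain j k where "j \<in> I" "k \<in> I" "norm (fst z - p j) \<le> r" "norm (snd z - p k) \<le> r"
      using spreadD[OF fstP[OF z] X] spreadD[OF sndP[OF z] Y] by blast
    moreover have "norm (snd z - fst z) \<le> 2 * r"
      using near[OF z] by (simp add: norm_minus_commute)
    ultimately show ?thesis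
      using same[of i k "fst z" "snd z"] same[of i j "snd z" "fst z"] near[OF z] i by blast
  qed
  have "P' i \<in> matchings (image_mset ((+) (p i)) (X i)) (image_mset ((+) (p i)) (Y i))" if "i \<in> I" for i
  proof -
    have "P' i = filter_mset (\<lambda>z. norm (snd z - p i) \<le> r) P"
      unfolding P'_def using iff that by (intro filter_mset_cong) auto
    then have "image_mset snd (P' i) = image_mset ((+) (p i)) (Y i)"
      using filter_spread[OF that Y] by (simp add: filter_mset_image_mset flip: proj)
    moreover have "image_mset fst (P' i) = image_mset ((+) (p i)) (X i)"
      using filter_spread[OF that X] by (simp add: P'_def filter_mset_image_mset flip: proj)
    ultimately show ?thesis by (simp add: matchings_def)
  qed
  from Gdist_le_cost[OF this] have "(\<Sum>i\<in>I. (Gdist (X i) (Y i))\<^sup>2) \<le> (\<Sum>i\<in>I. cost (P' i))"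
    by (intro sum_mono) (simp add: Gdist_translate size)
  also have "\<dots> = cost P"
  proof -
    have "P = (\<Sum>i\<in>I. P' i)"
      unfolding P'_def
    proof (rule mset_partition[OF fin])
      fix z assume "z \<in># P"
      then obtain i where "i \<in> I" "norm (fst z - p i) \<le> r"
        using spreadD[OF fstP X] by blast
      moreover have "j = i" if "j \<in> I \<and> norm (fst z - p j) \<le> r" for j
        using same[of j i "fst z" "fst z"] that calculation r(1) by simp
      ultimately show "\<exists>!i. i \<in> I \<and> norm (fst z - p i) \<le> r" by blast
    qed
    then show ?thesis using cost_sum by metis
  qed
  finally show "(\<Sum>i\<in>I. (Gdist (X i) (Y i))\<^sup>2) \<le> (Gdist (spread p I X) (spread p I Y))\<^sup>2"
    using P(2) by simp
qed

lemma exists_separation: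
  fixes p :: "'i \<Rightarrow> 'a::real_normed_vector"
  assumes "finite I" "inj_on p I"
  obtains \<delta> where "0 < \<delta>" "\<And>i j. i \<in> I \<Longrightarrow> j \<in> I \<Longrightarrow> i \<noteq> j \<Longrightarrow> \<delta> \<le> norm (p i - p j)"
proof -
  define D where "D = (\<lambda>(i, j). norm (p i - p j)) ` {(i, j) \<in> I \<times> I. i \<noteq> j}"
  have "finite D"
    unfolding D_def using assms(1) by (auto intro: finite_subset[of _ "I \<times> I"])
  moreover have "\<forall>d\<in>D. 0 < d"
    using assms(2) by (auto simp: D_def inj_on_def)
  \<comment> \<open>The inserted 1 keeps the minimum meaningful when there are fewer than two
    centres and \<open>D\<close> is empty.\<close>
  ultimately have "0 < Min (insert 1 D)" "\<forall>d\<in>D. Min (insert 1 D) \<le> d"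
    by (auto simp: Min_gr_iff)
  then show thesis using that[of "Min (insert 1 D)"] by (auto simp: D_def)
qed

section \<open>Clusters shrinking to their centres\<close>

lemma sqnorm_sum_dilate: "(\<Sum>i\<in>I. sqnorm (dilate t X i)) = t\<^sup>2 * (\<Sum>i\<in>I. sqnorm (X i))"
  by (simp add: dilate_def sqnorm_scale sum_distrib_left)

text \<open>For small parameters all dilated clusters have radius at most
  \<open>\<delta> / 5\<close>, and \<open>4 * (\<delta> / 5) < \<delta>\<close>. Allowing two
  families and two times covers both uses: one family at two times shows that a ray is a geodesic,
  two families at one time compute \<open>dA\<close>.\<close>

lemma Gdist_spread_dilate:
  fixes X Y :: "'i \<Rightarrow> (real ^ 'n) multiset"
  assumes "finite I" "inj_on p I" and size: "\<And>i. i \<in> I \<Longrightarrow> size (X i) = size (Y i)"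
  obtains \<epsilon> where "0 < \<epsilon>" "\<And>s t. s \<in> {0..\<epsilon>} \<Longrightarrow> t \<in> {0..\<epsilon>} \<Longrightarrow>
    (Gdist (spread p I (dilate s X)) (spread p I (dilate t Y)))\<^sup>2 =
    (\<Sum>i\<in>I. (Gdist (dilate s X i) (dilate t Y i))\<^sup>2)"
proof -
  obtain \<delta> where \<delta>: "0 < \<delta>" "\<And>i j. i \<in> I \<Longrightarrow> j \<in> I \<Longrightarrow> i \<noteq> j \<Longrightarrow> \<delta> \<le> norm (p i - p j)"
    using exists_separation assms by metis
  \<comment> \<open>The summand 1 gives \<open>1 \<le> M\<close>, hence
    \<open>M \<le> M\<^sup>2\<close>, so both sums are bounded by the square of
    \<open>M\<close>.\<close>
  define M where "M = 1 + (\<Sum>i\<in>I. sqnorm (X i)) + (\<Sum>i\<in>I. sqnorm (Y i))"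
  have nn: "0 \<le> (\<Sum>i\<in>I. sqnorm (X i))" "0 \<le> (\<Sum>i\<in>I. sqnorm (Y i))"
    by (auto intro!: sum_nonneg sqnorm_nonneg)
  then have M: "1 \<le> M" by (simp add: M_def)
  then have "M \<le> M\<^sup>2" by (simp add: power2_eq_square)
  then have XM: "(\<Sum>i\<in>I. sqnorm (X i)) \<le> M\<^sup>2" and YM: "(\<Sum>i\<in>I. sqnorm (Y i)) \<le> M\<^sup>2"
    using nn unfolding M_def by linarith+
  define \<epsilon> where "\<epsilon> = \<delta> / (5 * M)"
  have small: "(\<Sum>i\<in>I. sqnorm (dilate u Z i)) \<le> (\<delta> / 5)\<^sup>2"
    if "u \<in> {0..\<epsilon>}" "(\<Sum>i\<in>I. sqnorm (Z i)) \<le> M\<^sup>2" for u and Z :: "'i \<Rightarrow> (real^'n) multiset"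
  proof -
    have "(\<Sum>i\<in>I. sqnorm (dilate u Z i)) \<le> u\<^sup>2 * M\<^sup>2"
      unfolding sqnorm_sum_dilate using that by (intro mult_left_mono) auto
    also have "\<dots> = (u * M)\<^sup>2" by (simp add: power_mult_distrib)
    also have "\<dots> \<le> (\<delta> / 5)\<^sup>2"
      using that M by (intro power_mono) (auto simp: \<epsilon>_def field_simps)
    finally show ?thesis .
  qed
  show thesis
  proof
    show "0 < \<epsilon>" using \<delta> M by (simp add: \<epsilon>_def)
    fix s t assume st: "s \<in> {0..\<epsilon>}" "t \<in> {0..\<epsilon>}"
    show "(Gdist (spread p I (dilate s X)) (spread p I (dilate t Y)))\<^sup>2 =
      (\<Sum>i\<in>I. (Gdist (dilate s X i) (dilate t Y i))\<^sup>2)"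
      using \<delta> size small[OF st(1) XM] small[OF st(2) YM]
      by (intro Gdist_spread[OF assms(1), of \<delta> p _ _ "\<delta> / 5"]) auto
  qed
qed

section \<open>Geodesics near their origin\<close>

text \<open>The three values are those of the equality case of Cauchy-Schwarz: they make the sum of
  the nonnegative terms \<open>?f z\<close> vanish, so each term vanishes.\<close>

lemma cost_extremal_proportional:
  fixes P :: "('a::real_inner \<times> 'a) multiset"
  assumes "(\<Sum>z\<in>#P. (norm (fst z))\<^sup>2) = c\<^sup>2 * s\<^sup>2" "(\<Sum>z\<in>#P. (norm (snd z))\<^sup>2) = c\<^sup>2 * t\<^sup>2"
    and "cost P = c\<^sup>2 * (t - s)\<^sup>2" "z \<in># P"
  shows "t *\<^sub>R fst z = s *\<^sub>R snd z"
proof -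
  let ?f = "\<lambda>z::'a \<times> 'a. (norm (t *\<^sub>R fst z - s *\<^sub>R snd z))\<^sup>2"
  \<comment> \<open>The coefficients are chosen so that only the three prescribed sums occur.\<close>
  have "?f z = (t * (t - s)) * (norm (fst z))\<^sup>2 + (s * (s - t)) * (norm (snd z))\<^sup>2
      + (s * t) * (norm (fst z - snd z))\<^sup>2" for z
    unfolding power2_norm_eq_inner
    by (simp add: inner_diff_left inner_diff_right inner_commute algebra_simps)
  then have "(\<Sum>z\<in>#P. ?f z) = (t * (t - s)) * (\<Sum>z\<in>#P. (norm (fst z))\<^sup>2)
      + (s * (s - t)) * (\<Sum>z\<in>#P. (norm (snd z))\<^sup>2) + (s * t) * cost P"
    by (simp add: cost_def sum_mset.distrib sum_mset_distrib_left)
  also have "\<dots> = 0"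
    unfolding assms by (simp add: power2_eq_square algebra_simps)
  finally have "?f z = 0"
    using assms(4) by (intro sum_mset_eq_0_member[of P ?f]) auto
  then show ?thesis by simp
qed

section \<open>Displacement families for tuples near \<open>A\<close>\<close>

lemma size_filter_fst: "size (filter_mset (\<lambda>z. fst z = a) P) = count (image_mset fst P) a"
  by (induction P) auto

lemma spread_zeros:
  fixes p :: "'i \<Rightarrow> 'a::comm_monoid_add"
  assumes "finite I" "inj_on p I" "p ` I = set_mset A"
  shows "spread p I (\<lambda>i. replicate_mset (count A (p i)) 0) = A"
proof -
  have "A = (\<Sum>i\<in>I. filter_mset (\<lambda>a. a = p i) A)"
  proof (rule mset_partition[OF assms(1)])
    fix a assume "a \<in># A"
    then show "\<exists>!i. i \<in> I \<and> a = p i"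
      using assms(2) unfolding assms(3)[symmetric] by (auto dest: inj_onD)
  qed
  then show ?thesis by (simp add: spread_def filter_eq_replicate_mset)
qed

lemma dilate_0: "dilate 0 X i = replicate_mset (size (X i)) 0"
proof -
  have "image_mset ((*\<^sub>R) 0) (X i) = image_mset (\<lambda>_. 0) (X i)" by (intro image_mset_cong) simp
  then show ?thesis by (simp add: dilate_def image_mset_const_eq)
qed

lemma spread_dilate_0:
  assumes "finite I" "inj_on p I" "p ` I = set_mset A" "\<And>i. i \<in> I \<Longrightarrow> size (X i) = count A (p i)"
  shows "spread p I (dilate 0 X) = A"
proof -
  have "spread p I (dilate 0 X) = spread p I (\<lambda>i. replicate_mset (count A (p i)) 0)"
    unfolding spread_def by (intro sum.cong) (auto simp: dilate_0 assms(4))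
  then show ?thesis using spread_zeros[OF assms(1-3)] by simp
qed

text \<open>An optimal matching of \<open>A\<close> with \<open>B\<close> is grouped by its first
  component: \<open>X i\<close> collects the displacements of the points matched with a copy of
  \<open>p i\<close>. The family depends on the chosen matching.\<close>

lemma cluster_decomposition:
  fixes A B :: "(real ^ 'n) multiset"
  assumes "finite I" "inj_on p I" "p ` I = set_mset A" "size A = size B"
  obtains X where "B = spread p I X" "\<And>i. i \<in> I \<Longrightarrow> size (X i) = count A (p i)"
    "(\<Sum>i\<in>I. sqnorm (X i)) = (Gdist A B)\<^sup>2"
proof -
  obtain P where P: "P \<in> matchings A B" "cost P = (Gdist A B)\<^sup>2"
    using Gdist_optimal assms(4) by blast
  then have proj: "image_mset fst P = A" "image_mset snd P = B"
    by (auto simp: matchings_def)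
  define P' where "P' i = filter_mset (\<lambda>z. fst z = p i) P" for i
  define X where "X i = image_mset (\<lambda>z. snd z - p i) (P' i)" for i
  have sum: "P = (\<Sum>i\<in>I. P' i)"
    unfolding P'_def
  proof (rule mset_partition[OF assms(1)])
    fix z assume "z \<in># P"
    then have "fst z \<in> p ` I"
      unfolding assms(3) by (auto simp flip: proj)
    then show "\<exists>!i. i \<in> I \<and> fst z = p i"
      using assms(2) by (metis imageE inj_onD)
  qed
  show thesis
  proof
    have "image_mset ((+) (p i)) (X i) = image_mset snd (P' i)" for i
      by (simp add: X_def multiset.map_comp comp_def)
    then show "B = spread p I X"
      by (simp add: spread_def flip: proj image_mset_sum sum)
    show "size (X i) = count A (p i)" for i
      by (simp add: X_def P'_def size_filter_fst proj)
    have "sqnorm (X i) = cost (P' i)" for i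
    proof -
      have "sqnorm (X i) = (\<Sum>z\<in>#P' i. (norm (snd z - p i))\<^sup>2)"
        by (simp add: sqnorm_def X_def multiset.map_comp comp_def)
      also have "\<dots> = cost (P' i)"
        unfolding cost_def by (intro arg_cong[of _ _ sum_mset] image_mset_cong)
          (auto simp: P'_def norm_minus_commute)
      finally show ?thesis .
    qed
    then show "(\<Sum>i\<in>I. sqnorm (X i)) = (Gdist A B)\<^sup>2"
      by (simp add: P(2)[symmetric] flip: cost_sum sum)
  qed
qed

text \<open>Near its origin a geodesic is a ray in the chart \<open>spread p I\<close>. Each tuple
  is decomposed into clusters, and rigidity of the matching between times \<open>\<epsilon>\<close>
  and \<open>t\<close> shows that the displacements are proportional.\<close>

lemma geodesic_local_form:
  fixes A :: "(real ^ 'n) multiset"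
  assumes geo: "geodesic Q A (T, \<gamma>)" and I: "finite I" "inj_on p I" "p ` I = set_mset A"
  obtains \<epsilon> X where "0 < \<epsilon>" "\<And>i. i \<in> I \<Longrightarrow> size (X i) = count A (p i)"
    "\<And>t. t \<in> {0..\<epsilon>} \<Longrightarrow> \<gamma> t = spread p I (dilate t X)"
proof -
  obtain c where T: "0 < T" and \<gamma>0: "\<gamma> 0 = A" and \<gamma>Q: "\<And>t. t \<in> {0..T} \<Longrightarrow> size (\<gamma> t) = Q"
    and c: "0 \<le> c" "\<And>s t. s \<in> {0..T} \<Longrightarrow> t \<in> {0..T} \<Longrightarrow> Gdist (\<gamma> s) (\<gamma> t) = c * \<bar>t - s\<bar>"
    using geo by (auto simp: geodesic_def QQ_def)
  obtain \<delta> where \<delta>: "0 < \<delta>" "\<And>i j. i \<in> I \<Longrightarrow> j \<in> I \<Longrightarrow> i \<noteq> j \<Longrightarrow> \<delta> \<le> norm (p i - p j)"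
    using exists_separation I by metis
  \<comment> \<open>The bound keeps every displacement up to time \<open>\<epsilon>\<close> below
    \<open>\<delta> / 5\<close>; the denominator uses \<open>c + 1\<close> because a constant
    geodesic has \<open>c = 0\<close>.\<close>
  define \<epsilon> where "\<epsilon> = min T (\<delta> / (5 * (c + 1)))"
  have \<epsilon>: "0 < \<epsilon>" "\<epsilon> \<le> T" "c * \<epsilon> \<le> \<delta> / 5"
  proof -
    show "0 < \<epsilon>" "\<epsilon> \<le> T" using T \<delta>(1) c(1) by (auto simp: \<epsilon>_def)
    have "c * \<epsilon> \<le> (c + 1) * (\<delta> / (5 * (c + 1)))"
      using c(1) \<delta>(1) \<open>0 < \<epsilon>\<close> by (intro mult_mono) (auto simp: \<epsilon>_def)
    also have "\<dots> = \<delta> / 5" using c(1) by (simp add: field_simps)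
    finally show "c * \<epsilon> \<le> \<delta> / 5" .
  qed
  \<comment> \<open>The decompositions are chosen separately for each time, so at this stage nothing
    relates the families at different times.\<close>
  have "\<exists>X. \<gamma> t = spread p I X \<and> (\<forall>i\<in>I. size (X i) = count A (p i)) \<and>
      (\<Sum>i\<in>I. sqnorm (X i)) = c\<^sup>2 * t\<^sup>2" if t: "t \<in> {0..T}" for t
  proof -
    have "size A = size (\<gamma> t)" using \<gamma>Q[of 0] \<gamma>Q[OF t] \<gamma>0 T by simp
    then obtain X where "\<gamma> t = spread p I X" "\<And>i. i \<in> I \<Longrightarrow> size (X i) = count A (p i)"
      "(\<Sum>i\<in>I. sqnorm (X i)) = (Gdist A (\<gamma> t))\<^sup>2"
      using cluster_decomposition[OF I] by metis
    moreover have "Gdist A (\<gamma> t) = c * t" using c(2)[of 0 t] t \<gamma>0 T by simp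
    ultimately show ?thesis by (auto simp: power_mult_distrib)
  qed
  then obtain X where X: "\<And>t. t \<in> {0..T} \<Longrightarrow> \<gamma> t = spread p I (X t)"
    "\<And>t i. t \<in> {0..T} \<Longrightarrow> i \<in> I \<Longrightarrow> size (X t i) = count A (p i)"
    "\<And>t. t \<in> {0..T} \<Longrightarrow> (\<Sum>i\<in>I. sqnorm (X t i)) = c\<^sup>2 * t\<^sup>2"
    by metis
  \<comment> \<open>The initial velocity is read off from the displacements at the single time
    \<open>\<epsilon>\<close>.\<close>
  define V where "V = dilate (1 / \<epsilon>) (X \<epsilon>)"
  have \<epsilon>T: "\<epsilon> \<in> {0..T}" using \<epsilon> by simp
  have size_V: "size (V i) = count A (p i)" if "i \<in> I" for i
    using X(2)[OF \<epsilon>T that] by (simp add: V_def)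
  have "\<gamma> t = spread p I (dilate t V)" if "t \<in> {0..\<epsilon>}" for t
  proof (cases "t = 0")
    case True
    then show ?thesis using spread_dilate_0[OF I size_V] \<gamma>0 by simp
  next
    case False
    have tT: "t \<in> {0..T}" using that \<epsilon> by auto
    have small: "(\<Sum>i\<in>I. sqnorm (X u i)) \<le> (\<delta> / 5)\<^sup>2" if "u \<in> {0..\<epsilon>}" for u
    proof -
      have "c * u \<le> c * \<epsilon>" using that c(1) by (intro mult_left_mono) auto
      then have "(c * u)\<^sup>2 \<le> (\<delta> / 5)\<^sup>2"
        using that c(1) \<epsilon>(3) by (intro power_mono) auto
      then show ?thesis using X(3)[of u] that \<epsilon> by (simp add: power_mult_distrib)
    qed
    have sz: "size (X \<epsilon> i) = size (X t i)" if "i \<in> I" for i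
      using X(2)[OF \<epsilon>T that] X(2)[OF tT that] by simp
    have "(Gdist (spread p I (X \<epsilon>)) (spread p I (X t)))\<^sup>2 = (\<Sum>i\<in>I. (Gdist (X \<epsilon> i) (X t i))\<^sup>2)"
    proof (rule Gdist_spread[OF I(1) \<delta>(2) sz])
      show "(\<Sum>i\<in>I. sqnorm (X \<epsilon> i)) \<le> (\<delta> / 5)\<^sup>2" "(\<Sum>i\<in>I. sqnorm (X t i)) \<le> (\<delta> / 5)\<^sup>2"
        using small \<epsilon>(1) \<open>t \<in> {0..\<epsilon>}\<close> by auto
    qed (use \<delta>(1) in auto)
    then have "(\<Sum>i\<in>I. (Gdist (X \<epsilon> i) (X t i))\<^sup>2) = (Gdist (\<gamma> \<epsilon>) (\<gamma> t))\<^sup>2"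
      by (simp add: X(1)[OF \<epsilon>T] X(1)[OF tT])
    also have "\<dots> = c\<^sup>2 * (t - \<epsilon>)\<^sup>2"
      by (simp add: c(2)[OF \<epsilon>T tT] power_mult_distrib)
    finally have G: "(\<Sum>i\<in>I. (Gdist (X \<epsilon> i) (X t i))\<^sup>2) = c\<^sup>2 * (t - \<epsilon>)\<^sup>2" .
    have "\<forall>i\<in>I. \<exists>P. P \<in> matchings (X \<epsilon> i) (X t i) \<and> cost P = (Gdist (X \<epsilon> i) (X t i))\<^sup>2"
    proof
      fix i assume "i \<in> I"
      from Gdist_optimal[OF sz[OF this]]
      show "\<exists>P. P \<in> matchings (X \<epsilon> i) (X t i) \<and> cost P = (Gdist (X \<epsilon> i) (X t i))\<^sup>2" by blast
    qed
    then obtain P where P: "\<And>i. i \<in> I \<Longrightarrow> P i \<in> matchings (X \<epsilon> i) (X t i)"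
      "\<And>i. i \<in> I \<Longrightarrow> cost (P i) = (Gdist (X \<epsilon> i) (X t i))\<^sup>2"
      by metis
    have fst: "image_mset fst (P i) = X \<epsilon> i" and snd: "image_mset snd (P i) = X t i" if "i \<in> I" for i
      using P(1)[OF that] by (auto simp: matchings_def)
    have "X t i = dilate t V i" if i: "i \<in> I" for i
    proof -
      \<comment> \<open>The squared norms and the cost are known only as totals over all clusters,
        so the extremal argument is applied to the sum of the matchings \<open>P i\<close> rather
        than to one of them.\<close>
      have "t *\<^sub>R fst z = \<epsilon> *\<^sub>R snd z" if "z \<in># P i" for z
      proof (rule cost_extremal_proportional)
        show "z \<in># (\<Sum>i\<in>I. P i)" using that i I(1) by (auto simp: set_mset_sum)
        show "cost (\<Sum>i\<in>I. P i) = c\<^sup>2 * (t - \<epsilon>)\<^sup>2"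
          using P(2) G by (simp add: cost_sum)
        have "(\<Sum>z\<in>#(\<Sum>i\<in>I. P i). (norm (fst z))\<^sup>2) = (\<Sum>i\<in>I. \<Sum>z\<in>#P i. (norm (fst z))\<^sup>2)"
          by (simp add: image_mset_sum sum_mset_sum)
        also have "\<dots> = (\<Sum>i\<in>I. sqnorm (X \<epsilon> i))"
          by (intro sum.cong) (simp_all add: sqnorm_def multiset.map_comp comp_def flip: fst)
        finally show "(\<Sum>z\<in>#(\<Sum>i\<in>I. P i). (norm (fst z))\<^sup>2) = c\<^sup>2 * \<epsilon>\<^sup>2"
          using X(3)[OF \<epsilon>T] by simp
        have "(\<Sum>z\<in>#(\<Sum>i\<in>I. P i). (norm (snd z))\<^sup>2) = (\<Sum>i\<in>I. \<Sum>z\<in>#P i. (norm (snd z))\<^sup>2)"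
          by (simp add: image_mset_sum sum_mset_sum)
        also have "\<dots> = (\<Sum>i\<in>I. sqnorm (X t i))"
          by (intro sum.cong) (simp_all add: sqnorm_def multiset.map_comp comp_def flip: snd)
        finally show "(\<Sum>z\<in>#(\<Sum>i\<in>I. P i). (norm (snd z))\<^sup>2) = c\<^sup>2 * t\<^sup>2"
          using X(3)[OF tT] by simp
      qed
      then have "snd z = (t / \<epsilon>) *\<^sub>R fst z" if "z \<in># P i" for z
      proof -
        have "(t / \<epsilon>) *\<^sub>R fst z = (1 / \<epsilon>) *\<^sub>R (t *\<^sub>R fst z)" by simp
        also have "\<dots> = (1 / \<epsilon>) *\<^sub>R (\<epsilon> *\<^sub>R snd z)"
          by (simp only: \<open>\<And>z. z \<in># P i \<Longrightarrow> t *\<^sub>R fst z = \<epsilon> *\<^sub>R snd z\<close>[OF that])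
        finally show ?thesis using \<epsilon>(1) by simp
      qed
      then have "image_mset snd (P i) = image_mset (\<lambda>z. (t / \<epsilon>) *\<^sub>R fst z) (P i)"
        by (intro image_mset_cong)
      then show ?thesis
        by (simp add: V_def dilate_def multiset.map_comp comp_def snd[OF i] flip: fst[OF i])
    qed
    then have "spread p I (X t) = spread p I (dilate t V)"
      unfolding spread_def by (intro sum.cong) auto
    then show ?thesis using X(1)[OF tT] by simp
  qed
  with \<epsilon>(1) size_V that show thesis by blast
qed

text \<open>Near zero the metric splits over the clusters, and in each cluster
  \<open>Gdist_scale_same\<close> applies. The speed is the square root of the total squared norm of
  the displacements.\<close>

lemma geodesic_spread_dilate:
  fixes A :: "(real ^ 'n) multiset"
  assumes "A \<in> QQ Q" and I: "finite I" "inj_on p I" "p ` I = set_mset A"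
    and X: "\<And>i. i \<in> I \<Longrightarrow> size (X i) = count A (p i)"
  obtains \<epsilon> where "geodesic Q A (\<epsilon>, \<lambda>t. spread p I (dilate t X))"
proof -
  obtain \<epsilon> where \<epsilon>: "0 < \<epsilon>" "\<And>s t. s \<in> {0..\<epsilon>} \<Longrightarrow> t \<in> {0..\<epsilon>} \<Longrightarrow>
    (Gdist (spread p I (dilate s X)) (spread p I (dilate t X)))\<^sup>2 =
    (\<Sum>i\<in>I. (Gdist (dilate s X i) (dilate t X i))\<^sup>2)"
    using Gdist_spread_dilate[OF I(1,2), of X X] by blast
  have size: "size (spread p I (dilate t X)) = Q" for t
  proof -
    have "size (spread p I (dilate t X)) = size (spread p I (dilate 0 X))"
      by (simp add: size_spread)
    then show ?thesis
      using spread_dilate_0[OF I X] assms(1) by (simp add: QQ_def)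
  qed
  define c where "c = sqrt (\<Sum>i\<in>I. sqnorm (X i))"
  have "Gdist (spread p I (dilate s X)) (spread p I (dilate t X)) = c * \<bar>t - s\<bar>"
    if "s \<in> {0..\<epsilon>}" "t \<in> {0..\<epsilon>}" for s t
  proof (rule power2_eq_imp_eq)
    have "(Gdist (spread p I (dilate s X)) (spread p I (dilate t X)))\<^sup>2 = (\<Sum>i\<in>I. (t - s)\<^sup>2 * sqnorm (X i))"
      unfolding \<epsilon>(2)[OF that] dilate_def using that by (intro sum.cong Gdist_scale_same) auto
    also have "\<dots> = (c * \<bar>t - s\<bar>)\<^sup>2"
      by (simp add: c_def power_mult_distrib sum_nonneg sqnorm_nonneg flip: sum_distrib_left)
    finally show "(Gdist (spread p I (dilate s X)) (spread p I (dilate t X)))\<^sup>2 = (c * \<bar>t - s\<bar>)\<^sup>2" .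
    show "0 \<le> Gdist (spread p I (dilate s X)) (spread p I (dilate t X))"
      by (rule Gdist_nonneg) (simp add: size)
    show "0 \<le> c * \<bar>t - s\<bar>" by (simp add: c_def sum_nonneg sqnorm_nonneg)
  qed
  moreover have "0 \<le> c" by (simp add: c_def sum_nonneg sqnorm_nonneg)
  ultimately have "geodesic Q A (\<epsilon>, \<lambda>t. spread p I (dilate t X))"
    using \<epsilon>(1) spread_dilate_0[OF I X] size by (auto simp: geodesic_def QQ_def)
  then show thesis by (rule that)
qed

text \<open>By splitting and homogeneity the difference quotient is constant near zero, which gives
  both the existence and the value of the limit in \<open>dA\<close>.\<close>

lemma Gdist_spread_dilate_eventually:
  fixes X Y :: "'i \<Rightarrow> (real ^ 'n) multiset"
  assumes "finite I" "inj_on p I" and size: "\<And>i. i \<in> I \<Longrightarrow> size (X i) = size (Y i)"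
  shows "\<forall>\<^sub>F t in at_right 0. Gdist (spread p I (dilate t X)) (spread p I (dilate t Y)) / t =
    sqrt (\<Sum>i\<in>I. (Gdist (X i) (Y i))\<^sup>2)"
proof -
  obtain \<epsilon> where \<epsilon>: "0 < \<epsilon>" "\<And>s t. s \<in> {0..\<epsilon>} \<Longrightarrow> t \<in> {0..\<epsilon>} \<Longrightarrow>
    (Gdist (spread p I (dilate s X)) (spread p I (dilate t Y)))\<^sup>2 =
    (\<Sum>i\<in>I. (Gdist (dilate s X i) (dilate t Y i))\<^sup>2)"
    using Gdist_spread_dilate[OF assms(1,2), of X Y] size by blast
  have "Gdist (spread p I (dilate t X)) (spread p I (dilate t Y)) / t =
    sqrt (\<Sum>i\<in>I. (Gdist (X i) (Y i))\<^sup>2)" if t: "0 < t" "t < \<epsilon>" for t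
  proof -
    have "0 \<le> Gdist (spread p I (dilate t X)) (spread p I (dilate t Y))"
      using size by (intro Gdist_nonneg) (simp add: size_spread)
    moreover have "(Gdist (spread p I (dilate t X)) (spread p I (dilate t Y)))\<^sup>2 =
      (\<Sum>i\<in>I. t\<^sup>2 * (Gdist (X i) (Y i))\<^sup>2)"
    proof -
      have "(Gdist (dilate t X i) (dilate t Y i))\<^sup>2 = t\<^sup>2 * (Gdist (X i) (Y i))\<^sup>2" if "i \<in> I" for i
        using Gdist_scale[OF size[OF that], of t] t by (simp add: dilate_def power_mult_distrib)
      then show ?thesis using \<epsilon>(2)[of t t] t by simp
    qed
    ultimately have "Gdist (spread p I (dilate t X)) (spread p I (dilate t Y)) =
      sqrt (t\<^sup>2 * (\<Sum>i\<in>I. (Gdist (X i) (Y i))\<^sup>2))"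
      by (simp only: real_sqrt_unique flip: sum_distrib_left)
    also have "\<dots> = t * sqrt (\<Sum>i\<in>I. (Gdist (X i) (Y i))\<^sup>2)"
      unfolding real_sqrt_mult using t by (simp only: real_sqrt_abs abs_of_pos)
    finally show ?thesis using t by (simp only: nonzero_mult_div_cancel_left less_imp_neq[THEN not_sym] not_False_eq_True)
  qed
  then show ?thesis
    unfolding eventually_at_right_field using \<epsilon>(1) by blast
qed

section \<open>Completeness\<close>

lemma Gdist_add_mset_le:
  assumes "size A = size B"
  shows "(Gdist (add_mset a A) (add_mset b B))\<^sup>2 \<le> (norm (a - b))\<^sup>2 + (Gdist A B)\<^sup>2"
proof -
  obtain P where P: "P \<in> matchings A B" "cost P = (Gdist A B)\<^sup>2"
    using Gdist_optimal assms by blast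
  then have "add_mset (a, b) P \<in> matchings (add_mset a A) (add_mset b B)"
    by (auto simp: matchings_def)
  from Gdist_le_cost[OF this] show ?thesis using P(2) by (simp add: cost_def)
qed

text \<open>Bolzano-Weierstrass by induction on the size: one point is split off from each multiset
  and made convergent along a subsequence, and the remainders are treated along that
  subsequence.\<close>

lemma bounded_multisets_subsequence:
  fixes X :: "nat \<Rightarrow> (real ^ 'n) multiset"
  assumes "\<And>m. size (X m) = k" "\<And>m x. x \<in># X m \<Longrightarrow> norm x \<le> M"
  shows "\<exists>r L. strict_mono r \<and> size L = k \<and> (\<lambda>m. Gdist (X (r m)) L) \<longlonglongrightarrow> 0"
  using assms
proof (induction k arbitrary: X)
  case 0
  then have "Gdist (X (id m)) {#} = 0" for m
    by (simp add: Gdist_eq_0_iff)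
  then show ?case
    by (intro exI[of _ id] exI[of _ "{#}"]) (auto simp: strict_mono_def)
next
  case (Suc k)
  have "\<exists>x Y. X m = add_mset x Y" for m
    using Suc.prems(1)[of m] by (metis size_eq_Suc_imp_eq_union)
  then obtain x Y where XY: "\<And>m. X m = add_mset (x m) (Y m)" by metis
  have "bounded (range x)"
    using Suc.prems(2) XY by (intro boundedI[of _ M]) auto
  then obtain l r where r: "strict_mono r" "(x \<circ> r) \<longlonglongrightarrow> l"
    using bounded_imp_convergent_subsequence by blast
  have "size (Y (r m)) = k" "\<And>y. y \<in># Y (r m) \<Longrightarrow> norm y \<le> M" for m
    using Suc.prems(1)[of "r m"] Suc.prems(2)[of _ "r m"] XY[of "r m"] by auto
  then obtain q L where q: "strict_mono q" "size L = k" "(\<lambda>m. Gdist (Y (r (q m))) L) \<longlonglongrightarrow> 0"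
    using Suc.IH[of "\<lambda>m. Y (r m)"] by auto
  have sY: "size (Y m) = size L" for m using Suc.prems(1)[of m] XY[of m] q(2) by simp
  have "(\<lambda>m. x (r (q m))) \<longlonglongrightarrow> l"
    using LIMSEQ_subseq_LIMSEQ[OF r(2) q(1)] by (simp add: comp_def)
  then have "(\<lambda>m. sqrt ((norm (x (r (q m)) - l))\<^sup>2 + (Gdist (Y (r (q m))) L)\<^sup>2)) \<longlonglongrightarrow> sqrt ((norm (l - l))\<^sup>2 + 0\<^sup>2)"
    using q(3) by (intro tendsto_intros)
  then have lim: "(\<lambda>m. sqrt ((norm (x (r (q m)) - l))\<^sup>2 + (Gdist (Y (r (q m))) L)\<^sup>2)) \<longlonglongrightarrow> 0"
    by simp
  have "(\<lambda>m. Gdist (X ((r \<circ> q) m)) (add_mset l L)) \<longlonglongrightarrow> 0"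
  proof (rule tendsto_sandwich[OF _ _ tendsto_const lim])
    show "\<forall>\<^sub>F m in sequentially. 0 \<le> Gdist (X ((r \<circ> q) m)) (add_mset l L)"
      using sY by (intro always_eventually allI Gdist_nonneg) (simp add: XY)
    show "\<forall>\<^sub>F m in sequentially. Gdist (X ((r \<circ> q) m)) (add_mset l L)
        \<le> sqrt ((norm (x (r (q m)) - l))\<^sup>2 + (Gdist (Y (r (q m))) L)\<^sup>2)"
      using Gdist_add_mset_le[OF sY]
      by (intro always_eventually allI real_le_rsqrt) (simp add: XY)
  qed
  moreover have "strict_mono (r \<circ> q)" using r q strict_mono_o by blast
  ultimately show ?case using q(2) by (intro exI[of _ "r \<circ> q"] exI[of _ "add_mset l L"]) (auto simp: comp_def)
qed

lemma norm_le_Gdist_zeros: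
  assumes "x \<in># X"
  shows "norm x \<le> Gdist X (replicate_mset (size X) 0)"
proof -
  have "(norm x)\<^sup>2 \<le> sqnorm X"
    unfolding sqnorm_def using assms by (intro sum_mset_ge_member) auto
  then have "(norm x)\<^sup>2 \<le> (Gdist X (replicate_mset (size X) 0))\<^sup>2"
    by (simp add: Gdist_zeros)
  then show ?thesis by (rule power2_le_imp_le) (simp add: Gdist_nonneg)
qed

text \<open>A Cauchy sequence is bounded, so a subsequence converges, and then so does the whole
  sequence.\<close>

lemma Gdist_complete:
  fixes X :: "nat \<Rightarrow> (real ^ 'n) multiset"
  assumes size: "\<And>m. size (X m) = k"
    and Cauchy: "\<And>e. 0 < e \<Longrightarrow> \<exists>N. \<forall>m\<ge>N. \<forall>l\<ge>N. Gdist (X m) (X l) < e"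
  shows "\<exists>L. size L = k \<and> (\<lambda>m. Gdist (X m) L) \<longlonglongrightarrow> 0"
proof -
  obtain N where N: "\<And>m. N \<le> m \<Longrightarrow> Gdist (X m) (X N) < 1"
    using Cauchy[of 1] by auto
  let ?O = "replicate_mset k (0 :: real^'n)"
  \<comment> \<open>Shifting by \<open>N\<close> lets one bound hold for all terms, as the
    compactness lemma demands.\<close>
  have "norm x \<le> 1 + Gdist (X N) ?O" if "x \<in># X (m + N)" for m x
  proof -
    have "norm x \<le> Gdist (X (m + N)) ?O"
      using norm_le_Gdist_zeros[OF that] by (simp add: size)
    also have "\<dots> \<le> Gdist (X (m + N)) (X N) + Gdist (X N) ?O"
      by (rule Gdist_triangle) (simp_all add: size)
    finally show ?thesis using N[of "m + N"] by simp
  qed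
  then obtain r L where r: "strict_mono r" "size L = k" "(\<lambda>m. Gdist (X (r m + N)) L) \<longlonglongrightarrow> 0"
    using bounded_multisets_subsequence[of "\<lambda>m. X (m + N)" k "1 + Gdist (X N) ?O"] size by auto
  have "(\<lambda>m. Gdist (X m) L) \<longlonglongrightarrow> 0"
  proof (rule LIMSEQ_I)
    fix e :: real assume e: "0 < e"
    obtain K where K: "\<And>m l. K \<le> m \<Longrightarrow> K \<le> l \<Longrightarrow> Gdist (X m) (X l) < e / 2"
      using Cauchy[of "e / 2"] e by auto
    obtain K' where K': "\<And>m. K' \<le> m \<Longrightarrow> \<bar>Gdist (X (r m + N)) L\<bar> < e / 2"
      using LIMSEQ_D[OF r(3), of "e / 2"] e by auto
    have "norm (Gdist (X m) L - 0) < e" if "K \<le> m" for m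
    proof -
      let ?j = "max K K'"
      \<comment> \<open>A strictly increasing \<open>r\<close> dominates the identity, so the
        comparison term lies in the Cauchy range.\<close>
      have "K \<le> r ?j + N" using seq_suble[OF r(1), of ?j] by linarith
      then have "Gdist (X m) (X (r ?j + N)) < e / 2" using K that by blast
      moreover have "\<bar>Gdist (X (r ?j + N)) L\<bar> < e / 2" using K' by simp
      moreover have "Gdist (X m) L \<le> Gdist (X m) (X (r ?j + N)) + Gdist (X (r ?j + N)) L"
        by (rule Gdist_triangle) (simp_all add: size r(2))
      moreover have "0 \<le> Gdist (X m) L" by (rule Gdist_nonneg) (simp add: size r(2))
      ultimately show ?thesis by simp
    qed
    then show "\<exists>no. \<forall>m\<ge>no. norm (Gdist (X m) L - 0) < e" by blast
  qed
  then show ?thesis using r(2) by blast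
qed

section \<open>The product as a complete metric space\<close>

lemma prodQ_dist_L2: "prodQ_dist ks X Y = L2_set (\<lambda>i. Gdist (X i) (Y i)) {..<length ks}"
  by (simp add: prodQ_dist_def L2_set_def)

lemma prodQ_size: "X \<in> prodQ ks \<Longrightarrow> i < length ks \<Longrightarrow> size (X i) = ks ! i"
  by (simp add: prodQ_def QQ_def)

lemma Metric_space_prodQ: "Metric_space (prodQ ks) (prodQ_dist ks)"
proof
  fix X Y Z :: "nat \<Rightarrow> (real ^ 'n) multiset"
  show "0 \<le> prodQ_dist ks X Y" by (simp add: prodQ_dist_L2)
  show "prodQ_dist ks X Y = prodQ_dist ks Y X" by (simp add: prodQ_dist_def Gdist_commute)
  show "prodQ_dist ks X Y = 0 \<longleftrightarrow> X = Y" if "X \<in> prodQ ks" "Y \<in> prodQ ks"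
  proof -
    have "prodQ_dist ks X Y = 0 \<longleftrightarrow> (\<forall>i<length ks. Gdist (X i) (Y i) = 0)"
      by (auto simp: prodQ_dist_L2 L2_set_eq_0_iff)
    also have "\<dots> \<longleftrightarrow> (\<forall>i<length ks. X i = Y i)"
      using that by (simp add: Gdist_eq_0_iff prodQ_size)
    \<comment> \<open>Beyond the length of \<open>ks\<close> all members of \<open>prodQ ks\<close>
      take the value \<open>{#}\<close>, so agreement on the relevant indices is equality of
      functions.\<close>
    also have "\<dots> \<longleftrightarrow> X = Y"
      using that by (auto simp: prodQ_def fun_eq_iff) (metis not_less)
    finally show ?thesis .
  qed
  show "prodQ_dist ks X Z \<le> prodQ_dist ks X Y + prodQ_dist ks Y Z"
    if "X \<in> prodQ ks" "Y \<in> prodQ ks" "Z \<in> prodQ ks"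
  proof -
    have "prodQ_dist ks X Z \<le> L2_set (\<lambda>i. Gdist (X i) (Y i) + Gdist (Y i) (Z i)) {..<length ks}"
      unfolding prodQ_dist_L2 using that
      by (intro L2_set_mono) (auto intro!: Gdist_triangle Gdist_nonneg simp: prodQ_size)
    also have "\<dots> \<le> prodQ_dist ks X Y + prodQ_dist ks Y Z"
      unfolding prodQ_dist_L2 by (rule L2_set_triangle_ineq)
    finally show ?thesis .
  qed
qed

lemma mcomplete_prodQ: "Metric_space.mcomplete (prodQ ks) (prodQ_dist ks :: (nat \<Rightarrow> (real ^ 'n) multiset) \<Rightarrow> _)"
proof -
  interpret Metric_space "prodQ ks" "prodQ_dist ks :: (nat \<Rightarrow> (real ^ 'n) multiset) \<Rightarrow> _"
    by (rule Metric_space_prodQ)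
  show ?thesis
    unfolding mcomplete_def
  proof (intro allI impI)
    fix \<sigma> :: "nat \<Rightarrow> nat \<Rightarrow> (real ^ 'n) multiset"
    assume \<sigma>: "MCauchy \<sigma>"
    then have \<sigma>M: "\<And>m. \<sigma> m \<in> prodQ ks" by (auto simp: MCauchy_def)
    have "\<exists>L. size L = ks ! i \<and> (\<lambda>m. Gdist (\<sigma> m i) L) \<longlonglongrightarrow> 0" if i: "i < length ks" for i
    proof (rule Gdist_complete)
      show "size (\<sigma> m i) = ks ! i" for m using \<sigma>M i by (simp add: prodQ_size)
      fix e :: real assume "0 < e"
      then obtain N where N: "\<And>m l. N \<le> m \<Longrightarrow> N \<le> l \<Longrightarrow> prodQ_dist ks (\<sigma> m) (\<sigma> l) < e"
        using \<sigma> unfolding MCauchy_def by blast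
      have "Gdist (\<sigma> m i) (\<sigma> l i) \<le> prodQ_dist ks (\<sigma> m) (\<sigma> l)" for m l
        unfolding prodQ_dist_L2 using i by (intro member_le_L2_set) auto
      then show "\<exists>N. \<forall>m\<ge>N. \<forall>l\<ge>N. Gdist (\<sigma> m i) (\<sigma> l i) < e"
        using N by (meson le_less_trans)
    qed
    then obtain L where L: "\<And>i. i < length ks \<Longrightarrow> size (L i) = ks ! i"
      "\<And>i. i < length ks \<Longrightarrow> (\<lambda>m. Gdist (\<sigma> m i) (L i)) \<longlonglongrightarrow> 0"
      by metis
    define L' where "L' i = (if i < length ks then L i else {#})" for i
    have "L' \<in> prodQ ks" using L(1) by (auto simp: prodQ_def QQ_def L'_def)
    moreover have "(\<lambda>m. prodQ_dist ks (\<sigma> m) L') \<longlonglongrightarrow> sqrt (\<Sum>i<length ks. 0\<^sup>2)"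
      unfolding prodQ_dist_def using L(2) by (intro tendsto_intros) (auto simp: L'_def)
    ultimately show "\<exists>x. limitin mtopology \<sigma> x sequentially"
      using \<sigma>M by (auto simp: limitin_metric_dist_null)
  qed
qed

section \<open>The tangent cone\<close>

text \<open>Completing adds nothing when \<open>V\<close> preserves distances, is onto, and its
  target is complete. A Cauchy sequence of geodesics goes to a Cauchy sequence in \<open>M\<close>;
  sending it to the limit \<open>L\<close> preserves distances, so the classes forming
  \<open>Tan\<close> are the fibres of \<open>L\<close>.\<close>

lemma Tan_isometric:
  assumes V: "\<And>g. geodesic Q A g \<Longrightarrow> V g \<in> M"
    and surj: "\<And>x. x \<in> M \<Longrightarrow> \<exists>g. geodesic Q A g \<and> V g = x"
    and dA: "\<And>g h. geodesic Q A g \<Longrightarrow> geodesic Q A h \<Longrightarrow> dA g h = d (V g) (V h)"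
    and "Metric_space M d" "Metric_space.mcomplete M d"
  shows "\<exists>f. bij_betw f (Tan Q A) M \<and> (\<forall>X\<in>Tan Q A. \<forall>Y\<in>Tan Q A. d (f X) (f Y) = Tan_dist X Y)"
proof -
  interpret Metric_space M d by fact
  let ?C = "{\<sigma>. tan_cauchy Q A \<sigma>}"
  have geo: "geodesic Q A (\<sigma> k)" if "tan_cauchy Q A \<sigma>" for \<sigma> k
    using that by (simp add: tan_cauchy_def)
  have "\<exists>l. limitin mtopology (\<lambda>k. V (\<sigma> k)) l sequentially" if \<sigma>: "tan_cauchy Q A \<sigma>" for \<sigma>
  proof -
    have "\<exists>N. \<forall>m k. N \<le> m \<longrightarrow> N \<le> k \<longrightarrow> d (V (\<sigma> m)) (V (\<sigma> k)) < e" if "0 < e" for e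
    proof -
      obtain N where "\<And>m k. N \<le> m \<Longrightarrow> N \<le> k \<Longrightarrow> dA (\<sigma> m) (\<sigma> k) < e"
        using \<sigma> \<open>0 < e\<close> unfolding tan_cauchy_def by blast
      then show ?thesis using dA[OF geo[OF \<sigma>] geo[OF \<sigma>]] by auto
    qed
    then have "MCauchy (\<lambda>k. V (\<sigma> k))"
      using V[OF geo[OF \<sigma>]] by (auto simp: MCauchy_def)
    then show ?thesis using assms(5) by (simp add: mcomplete_def)
  qed
  then obtain L where L: "\<And>\<sigma>. tan_cauchy Q A \<sigma> \<Longrightarrow> limitin mtopology (\<lambda>k. V (\<sigma> k)) (L \<sigma>) sequentially"
    by metis
  have LM: "L \<sigma> \<in> M" and Lnull: "(\<lambda>k. d (V (\<sigma> k)) (L \<sigma>)) \<longlonglongrightarrow> 0" if "tan_cauchy Q A \<sigma>" for \<sigma>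
    using L[OF that] by (auto simp: limitin_metric_dist_null)
  \<comment> \<open>The quadrilateral inequality bounds the difference from the limit distance by
    two null sequences.\<close>
  have tan_dist: "tan_dist \<sigma> \<tau> = d (L \<sigma>) (L \<tau>)" if \<sigma>: "tan_cauchy Q A \<sigma>" and \<tau>: "tan_cauchy Q A \<tau>" for \<sigma> \<tau>
  proof -
    have "(\<lambda>k. dA (\<sigma> k) (\<tau> k) - d (L \<sigma>) (L \<tau>)) \<longlonglongrightarrow> 0"
    proof (rule Lim_null_comparison)
      show "(\<lambda>k. d (V (\<sigma> k)) (L \<sigma>) + d (V (\<tau> k)) (L \<tau>)) \<longlonglongrightarrow> 0"
        using tendsto_add[OF Lnull[OF \<sigma>] Lnull[OF \<tau>]] by simp
      have "norm (dA (\<sigma> k) (\<tau> k) - d (L \<sigma>) (L \<tau>)) \<le> d (V (\<sigma> k)) (L \<sigma>) + d (V (\<tau> k)) (L \<tau>)" for k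
      proof -
        note M = V[OF geo[OF \<sigma>, of k]] V[OF geo[OF \<tau>, of k]] LM[OF \<sigma>] LM[OF \<tau>]
        have "d (V (\<sigma> k)) (V (\<tau> k)) \<le> d (V (\<sigma> k)) (L \<sigma>) + (d (L \<sigma>) (L \<tau>) + d (L \<tau>) (V (\<tau> k)))"
          using triangle[OF M(1,3,2)] triangle[OF M(3,4,2)] by linarith
        moreover have "d (L \<sigma>) (L \<tau>) \<le> d (L \<sigma>) (V (\<sigma> k)) + (d (V (\<sigma> k)) (V (\<tau> k)) + d (V (\<tau> k)) (L \<tau>))"
          using triangle[OF M(3,1,4)] triangle[OF M(1,2,4)] by linarith
        ultimately show ?thesis
          using commute[of "L \<tau>" "V (\<tau> k)"] commute[of "L \<sigma>" "V (\<sigma> k)"] dA[OF geo[OF \<sigma>] geo[OF \<tau>]]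
          by simp
      qed
      then show "\<forall>\<^sub>F k in sequentially. norm (dA (\<sigma> k) (\<tau> k) - d (L \<sigma>) (L \<tau>))
          \<le> d (V (\<sigma> k)) (L \<sigma>) + d (V (\<tau> k)) (L \<tau>)" by simp
    qed
    then show ?thesis
      unfolding tan_dist_def by (intro limI) (rule LIM_zero_cancel)
  qed
  have cls: "{(\<sigma>, \<tau>). tan_cauchy Q A \<sigma> \<and> tan_cauchy Q A \<tau> \<and> tan_dist \<sigma> \<tau> = 0} `` {\<sigma>} =
      {\<tau>. tan_cauchy Q A \<tau> \<and> L \<tau> = L \<sigma>}" if "tan_cauchy Q A \<sigma>" for \<sigma>
    using that tan_dist LM by auto
  have Tan: "Tan Q A = (\<lambda>\<sigma>. {\<tau>. tan_cauchy Q A \<tau> \<and> L \<tau> = L \<sigma>}) ` ?C"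
    unfolding Tan_def quotient_def using cls by auto
  \<comment> \<open>The representative is the one that \<open>Tan_dist\<close> chooses, so the
    distance formula follows directly from \<open>tan_dist\<close>. Since \<open>L\<close> is
    constant on classes, the choice does not affect the value.\<close>
  define f where "f X = L (SOME \<sigma>. \<sigma> \<in> X)" for X
  have f: "tan_cauchy Q A (SOME \<sigma>. \<sigma> \<in> X) \<and> X = {\<tau>. tan_cauchy Q A \<tau> \<and> L \<tau> = f X}"
    if X: "X \<in> Tan Q A" for X
  proof -
    obtain \<sigma> where \<sigma>: "tan_cauchy Q A \<sigma>" "X = {\<tau>. tan_cauchy Q A \<tau> \<and> L \<tau> = L \<sigma>}"
      using X by (auto simp: Tan)
    define \<tau> where "\<tau> = (SOME \<sigma>. \<sigma> \<in> X)"
    have "\<sigma> \<in> X" using \<sigma> by simp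
    then have "\<tau> \<in> X" unfolding \<tau>_def by (metis someI_ex)
    then have "tan_cauchy Q A \<tau>" "L \<tau> = L \<sigma>" using \<sigma>(2) by auto
    moreover have "f X = L \<tau>" by (simp add: f_def \<tau>_def)
    ultimately show ?thesis using \<sigma>(2) unfolding \<tau>_def[symmetric] by simp
  qed
  have "bij_betw f (Tan Q A) M"
    unfolding bij_betw_def
  proof
    show "inj_on f (Tan Q A)"
    proof (rule inj_onI)
      fix X Y assume "X \<in> Tan Q A" "Y \<in> Tan Q A" "f X = f Y"
      then show "X = Y"
        using conjunct2[OF f[of X]] conjunct2[OF f[of Y]] by simp
    qed
    show "f ` Tan Q A = M"
    proof
      show "f ` Tan Q A \<subseteq> M"
        unfolding f_def using LM[OF conjunct1[OF f]] by blast
      show "M \<subseteq> f ` Tan Q A"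
      proof
        fix x assume "x \<in> M"
        then obtain g where g: "geodesic Q A g" "V g = x" using surj by blast
        \<comment> \<open>Points of \<open>M\<close> are reached by constant sequences.\<close>
        have const: "tan_cauchy Q A (\<lambda>_. g)"
          using g dA[OF g(1) g(1)] \<open>x \<in> M\<close> by (simp add: tan_cauchy_def)
        have "(\<lambda>k::nat. d x (L (\<lambda>_. g))) \<longlonglongrightarrow> 0"
          using Lnull[OF const] g(2) by simp
        then have "L (\<lambda>_. g) = x"
          using LM[OF const] \<open>x \<in> M\<close> by (metis LIMSEQ_const_iff zero)
        define X where "X = {\<tau>. tan_cauchy Q A \<tau> \<and> L \<tau> = L (\<lambda>_. g)}"
        have X: "X \<in> Tan Q A" using const by (auto simp: Tan X_def)
        have "(\<lambda>_. g) \<in> X" using const by (simp add: X_def)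
        then have "f X = x"
          by (subst (asm) conjunct2[OF f[OF X]]) (simp add: \<open>L (\<lambda>_. g) = x\<close>)
        then show "x \<in> f ` Tan Q A" using X by blast
      qed
    qed
  qed
  moreover have "d (f X) (f Y) = Tan_dist X Y" if "X \<in> Tan Q A" "Y \<in> Tan Q A" for X Y
    unfolding Tan_dist_def f_def
    using tan_dist[OF conjunct1[OF f[OF that(1)]] conjunct1[OF f[OF that(2)]]] by simp
  ultimately show ?thesis by blast
qed

lemma map_eq_of_mset_eq_image:
  assumes "mset ys = image_mset f M"
  shows "\<exists>xs. mset xs = M \<and> map f xs = ys"
  using assms
proof (induction ys arbitrary: M)
  case Nil
  then show ?case by simp
next
  case (Cons y ys)
  then obtain N x where N: "M = add_mset x N" "f x = y" "image_mset f N = mset ys"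
    using msed_map_invR[of f M y "mset ys"] by auto
  then obtain xs where "mset xs = N" "map f xs = ys" using Cons.IH[of N] by auto
  with N show ?case by (intro exI[of _ "x # xs"]) simp
qed

text \<open>The signature retains only the sorted multiplicities. Lifting that list along
  \<open>count A\<close> orders the support so that the \<open>i\<close>-th point has the
  \<open>i\<close>-th multiplicity.\<close>

lemma signature_enumeration:
  obtains as where "distinct as" "set as = set_mset A" "signature A = map (count A) as"
proof -
  have "mset (signature A) = image_mset (count A) (mset_set (set_mset A))"
    by (simp add: signature_def)
  then obtain as where as: "mset as = mset_set (set_mset A)" "map (count A) as = signature A"
    using map_eq_of_mset_eq_image by blast
  have set: "set as = set_mset A"
    using arg_cong[OF as(1), of set_mset] by simp
  have "distinct as"
    unfolding distinct_count_atmost_1 as(1) set by (simp add: count_mset_set')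
  with set as(2) that show thesis by metis
qed

theorem theorem3p7:
  fixes A :: "(real ^ 'n) multiset" and Q :: nat
  assumes "A \<in> QQ Q"
  shows "\<exists>f :: (nat \<Rightarrow> real \<times> (real \<Rightarrow> (real ^ 'n) multiset)) set \<Rightarrow> nat \<Rightarrow> (real ^ 'n) multiset.
           bij_betw f (Tan Q A) (prodQ (signature A)) \<and>
           (\<forall>X\<in>Tan Q A. \<forall>Y\<in>Tan Q A.
              prodQ_dist (signature A) (f X) (f Y) = Tan_dist X Y)"
proof -
  obtain as where as: "distinct as" "set as = set_mset A" "signature A = map (count A) as"
    using signature_enumeration by blast
  define p where "p = (!) as"
  define I where "I = {..<length as}"
  define ks where "ks = signature A"
  have I: "finite I" "inj_on p I" "p ` I = set_mset A"
    using as(1,2) by (auto simp: I_def p_def inj_on_nth set_conv_nth nth_eq_iff_index_eq inj_on_def)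
  have len: "length ks = length as" "\<And>i. i \<in> I \<Longrightarrow> ks ! i = count A (p i)"
    by (auto simp: ks_def as(3) I_def p_def)
  have prodQ_count: "size (X i) = count A (p i)" if "X \<in> prodQ ks" "i \<in> I" for X :: "nat \<Rightarrow> (real ^ 'n) multiset" and i
    using prodQ_size[OF that(1), of i] that(2) len by (simp add: I_def)
  \<comment> \<open>\<open>X\<close> is the initial velocity of \<open>g\<close>; only the germ of
    the curve at zero enters, as in the equivalence of geodesics.\<close>
  let ?tangent = "\<lambda>g X. X \<in> prodQ ks \<and> (\<forall>\<^sub>F t in at_right 0. snd g t = spread p I (dilate t X))"
  have dA: "dA g h = prodQ_dist ks X Y" if "?tangent g X" "?tangent h Y" for g h X Y
  proof -
    have "\<forall>\<^sub>F t in at_right 0. Gdist (spread p I (dilate t X)) (spread p I (dilate t Y)) / t =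
        sqrt (\<Sum>i\<in>I. (Gdist (X i) (Y i))\<^sup>2)"
      using that prodQ_count by (intro Gdist_spread_dilate_eventually[OF I(1,2)]) simp
    then have "\<forall>\<^sub>F t in at_right 0. Gdist (snd g t) (snd h t) / t = prodQ_dist ks X Y"
      using conjunct2[OF that(1)] conjunct2[OF that(2)]
      by eventually_elim (simp add: prodQ_dist_def len(1) I_def)
    then show ?thesis
      unfolding dA_def by (intro tendsto_Lim tendsto_eventually) simp
  qed
  have "\<exists>X. ?tangent g X" if geo: "geodesic Q A g" for g
  proof -
    obtain T \<gamma> where g: "g = (T, \<gamma>)" by fastforce
    obtain \<epsilon> X where X: "0 < \<epsilon>" "\<And>i. i \<in> I \<Longrightarrow> size (X i) = count A (p i)"
      "\<And>t. t \<in> {0..\<epsilon>} \<Longrightarrow> \<gamma> t = spread p I (dilate t X)"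
      by (rule geodesic_local_form[OF geo[unfolded g] I]) blast
    \<comment> \<open>\<open>spread\<close> sees only the indices in \<open>I\<close>; emptying the
      others places the family in \<open>prodQ ks\<close>.\<close>
    define Y where "Y i = (if i \<in> I then X i else {#})" for i
    have "spread p I (dilate t X) = spread p I (dilate t Y)" for t
      unfolding spread_def by (intro sum.cong) (auto simp: Y_def dilate_def)
    then have "\<forall>\<^sub>F t in at_right 0. snd g t = spread p I (dilate t Y)"
      unfolding eventually_at_right_field using X(1,3) g by (intro exI[of _ \<epsilon>]) auto
    moreover have "Y \<in> prodQ ks"
      using X(2) len by (auto simp: prodQ_def QQ_def Y_def I_def)
    ultimately show ?thesis by blast
  qed
  then obtain V where V: "\<And>g. geodesic Q A g \<Longrightarrow> ?tangent g (V g)" by metis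
  show ?thesis
    unfolding ks_def[symmetric]
  proof (rule Tan_isometric[where V = V])
    interpret Metric_space "prodQ ks" "prodQ_dist ks :: (nat \<Rightarrow> (real ^ 'n) multiset) \<Rightarrow> _"
      by (rule Metric_space_prodQ)
    fix X :: "nat \<Rightarrow> (real ^ 'n) multiset" assume X: "X \<in> prodQ ks"
    obtain \<epsilon> where g: "geodesic Q A (\<epsilon>, \<lambda>t. spread p I (dilate t X))"
      by (rule geodesic_spread_dilate[OF assms I prodQ_count[OF X]])
    let ?g = "(\<epsilon>, \<lambda>t. spread p I (dilate t X))"
    have t: "?tangent ?g X" using X by simp
    \<comment> \<open>\<open>V\<close> is an arbitrary choice of initial velocity. Both
      \<open>V ?g\<close> and \<open>X\<close> are tangent to the same curve, so their distance
      equals \<open>dA ?g ?g = 0\<close> and they coincide.\<close>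
    have "prodQ_dist ks (V ?g) X = dA ?g ?g" "dA ?g ?g = prodQ_dist ks X X"
      using dA[OF V[OF g] t] dA[OF t t] by simp_all
    then have "V ?g = X" using X V[OF g] by simp
    then show "\<exists>g. geodesic Q A g \<and> V g = X" using g by blast
  qed (use V dA Metric_space_prodQ mcomplete_prodQ in auto)
qed

end
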